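(* Let $X$ be an infinite dimensional separable Fréchet space. Then there exists an $\mathcal{AP}$-hypercyclic continuous linear operator $T:X\to X$.
   Context: $\mathcal{AP}$ is the family of all subsets of $\mathbb{N}$ that contain arbitrarily long (finite) arithmetic progressions $\{a,a+k,\dots,a+mk\}$ (common difference $k\ge 1$). $N_T(x,U)=\{n\in\mathbb{N}: T^n x\in U\}$. $T$ is $\mathcal{AP}$-hypercyclic if there is $x\in X$ such that $N_T(x,U)\in\mathcal{AP}$ for every nonempty open set $U\subseteq X$. *)

theory Defs
  imports "HOL-Analysis.Analysis"
begin

definition seminorm :: "('k::real_normed_field \<Rightarrow> 'a::ab_group_add \<Rightarrow> 'a) \<Rightarrow> ('a \<Rightarrow> real) \<Rightarrow> bool" where
  "seminorm smul p \<longleftrightarrow>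
     (\<forall>x y. p (x + y) \<le> p x + p y) \<and> (\<forall>c x. p (smul c x) = norm c * p x)"

(* The scalar multiplication is an explicit parameter so that real and complex spaces are
   treated alike; the type class on 'a supplies addition and a topology, without any
   compatibility between them.  Compatibility follows from frechet_space: the topology is
   the one generated by a separating sequence of seminorms, i.e. a neighbourhood base at x
   is given by the sets {y. \<forall>i\<le>n. p i (y - x) < e}. *)
definition generates_topology :: "(nat \<Rightarrow> 'a::{ab_group_add, topological_space} \<Rightarrow> real) \<Rightarrow> bool" where
  "generates_topology p \<longleftrightarrow>
     (\<forall>U. open U \<longleftrightarrow> (\<forall>x\<in>U. \<exists>n. \<exists>e>0. {y. \<forall>i\<le>n. p i (y - x) < e} \<subseteq> U))"

definition seminorm_Cauchy :: "(nat \<Rightarrow> 'a::ab_group_add \<Rightarrow> real) \<Rightarrow> (nat \<Rightarrow> 'a) \<Rightarrow> bool" where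
  "seminorm_Cauchy p s \<longleftrightarrow>
     (\<forall>n. \<forall>e>0. \<exists>N. \<forall>i\<ge>N. \<forall>j\<ge>N. p n (s i - s j) < e)"

(* Since the space is metrizable, completeness can be expressed by sequences. *)
locale frechet_space = vector_space smul
  for smul :: "'k::real_normed_field \<Rightarrow> 'a::{ab_group_add, topological_space} \<Rightarrow> 'a" +
  assumes frechet_seminorms:
    "\<exists>p :: nat \<Rightarrow> 'a \<Rightarrow> real.
       (\<forall>n. seminorm smul (p n)) \<and>
       (\<forall>x. (\<forall>n. p n x = 0) \<longrightarrow> x = 0) \<and>
       generates_topology p \<and>
       (\<forall>s. seminorm_Cauchy p s \<longrightarrow> (\<exists>l. s \<longlonglongrightarrow> l))"

definition infinite_dimensional :: "('k::field \<Rightarrow> 'a::ab_group_add \<Rightarrow> 'a) \<Rightarrow> bool" where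
  "infinite_dimensional smul \<longleftrightarrow> \<not> (\<exists>B. finite_dimensional_vector_space smul B)"

definition AP :: "nat set set" where
  "AP = {A. \<forall>m. \<exists>a k. k \<ge> 1 \<and> {a + j * k | j. j \<le> m} \<subseteq> A}"

definition return_set :: "('a \<Rightarrow> 'a) \<Rightarrow> 'a \<Rightarrow> 'a set \<Rightarrow> nat set" where
  "return_set T x U = {n. (T ^^ n) x \<in> U}"

definition AP_hypercyclic :: "('a::topological_space \<Rightarrow> 'a) \<Rightarrow> bool" where
  "AP_hypercyclic T \<longleftrightarrow> (\<exists>x. \<forall>U. open U \<and> U \<noteq> {} \<longrightarrow> return_set T x U \<in> AP)"

end

theory Submission
  imports Defs "HOL-Computational_Algebra.Polynomial"
begin

text \<open>
  The operator is modelled on the translation \<open>P(t) \<mapsto> P(t + 1)\<close> of polynomials.  Suppose that a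
  continuous linear operator \<open>T\<close> admits a linear map \<open>\<Phi>\<close> from polynomials into \<open>X\<close> with dense
  range such that \<open>T (\<Phi> P) = \<Phi> (P(t + 1))\<close>.  Then \<open>T\<close> is \<open>\<A>\<P>\<close>-hypercyclic, however irregular
  the topology that \<open>\<Phi>\<close> induces on polynomials.  Indeed, given polynomials \<open>U\<^sub>0, ..., U\<^sub>m\<close>, Hermite
  interpolation at the nodes \<open>0, ..., m\<close>, dilated by a large factor \<open>k\<close>, yields a polynomial whose
  translate by \<open>l k\<close> is close to \<open>U\<^sub>l\<close> for all \<open>l \<le> m\<close> at once
  (\<open>translation_model_tends_to\<close>).  Choosing one target for \<open>l = 0\<close> and another for \<open>l \<ge> 1\<close>, one
  finds in every nonempty open set vectors that visit a given nonempty open set at the times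
  \<open>k, 2 k, ..., m k\<close>, and Baire's theorem produces a single vector that does so for all \<open>m\<close> and all
  open sets (\<open>AP_hypercyclic_translation_model\<close>).

  On binomial polynomials translation by \<open>1\<close> is the identity plus the backward shift.  So it suffices
  to find in \<open>X\<close> a biorthogonal sequence \<open>x\<^sub>l, f\<^sub>l\<close> such that the \<open>x\<^sub>l\<close> span a dense subspace and
  \<open>\<Sum>\<^sub>l f\<^sub>l\<^sub>+\<^sub>1(v) x\<^sub>l\<close> defines a continuous operator (\<open>ex_biorthogonal_sequence\<close>).  It is built
  recursively from the Hahn--Banach theorem.  Always working with the first seminorm that the vectors
  chosen so far have not exhausted covers spaces on which some continuous seminorm has a kernel of
  infinite codimension as well as the space of all scalar sequences, where there is no such seminorm.
\<close>

section \<open>Norming functionals\<close>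

definition sublinear :: "(real \<Rightarrow> 'a::ab_group_add \<Rightarrow> 'a) \<Rightarrow> ('a \<Rightarrow> real) \<Rightarrow> bool" where
  "sublinear s q \<longleftrightarrow>
     (\<forall>x y. q (x + y) \<le> q x + q y) \<and> (\<forall>t x. t \<ge> 0 \<longrightarrow> q (s t x) = t * q x)"

lemma linear_addD: "Vector_Spaces.linear s1 s2 f \<Longrightarrow> f (x + y) = f x + f y"
  and linear_scaleD: "Vector_Spaces.linear s1 s2 f \<Longrightarrow> f (s1 c x) = s2 c (f x)"
  by (auto simp: Vector_Spaces.linear_iff)

lemma sublinear_add: "sublinear s q \<Longrightarrow> q (x + y) \<le> q x + q y"
  and sublinear_scale: "sublinear s q \<Longrightarrow> t \<ge> 0 \<Longrightarrow> q (s t x) = t * q x"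
  by (auto simp: sublinear_def)

context
  fixes s :: "real \<Rightarrow> 'a::ab_group_add \<Rightarrow> 'a"
  assumes vs: "vector_space s"
begin

interpretation vector_space s by (rule vs)

lemma sublinear_zero: "sublinear s q \<Longrightarrow> q 0 = 0"
  using sublinear_scale[of s q 0 0] by simp

lemma sublinear_minus: "sublinear s q \<Longrightarrow> - q (- x) \<le> q x"
  using sublinear_add[of s q x "- x"] sublinear_zero[of q] by simp

text \<open>
  Replacing \<open>q\<close> by the infimum of \<open>q (x + t z) - t q z\<close> over \<open>t \<ge> 0\<close> lowers it as far as
  possible while keeping its value at \<open>z\<close>, and makes \<open>- z\<close> take the opposite value.
  A sublinear functional that cannot be lowered is therefore additive, which is the key to the
  Hahn--Banach theorem below.
\<close>

lemma sublinear_flatten: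
  assumes q: "sublinear s q"
  obtains r where "sublinear s r" "\<And>x. r x \<le> q x" "\<And>x. r x \<le> q (x + z) - q z"
proof -
  define A where "A x = (\<lambda>t. q (x + s t z) - t * q z) ` {0..}" for x
  define r where "r x = Inf (A x)" for x
  have lower: "- q (- x) \<le> q (x + s t z) - t * q z" if "t \<ge> 0" for x t
  proof -
    have "q (s t z) \<le> q (- x) + q (x + s t z)"
      using sublinear_add[OF q, of "- x" "x + s t z"] by (simp add: algebra_simps)
    then show ?thesis using sublinear_scale[OF q that, of z] by simp
  qed
  have bdd: "bdd_below (A x)" for x
    by (rule bdd_belowI[of _ "- q (- x)"]) (auto simp: A_def lower)
  have ne: "A x \<noteq> {}" for x by (auto simp: A_def)
  have up: "r x \<le> q (x + s t z) - t * q z" if "t \<ge> 0" for x t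
    unfolding r_def by (rule cInf_lower[OF _ bdd]) (use that in \<open>auto simp: A_def\<close>)
  have greatest: "c \<le> r x" if "\<And>t. t \<ge> 0 \<Longrightarrow> c \<le> q (x + s t z) - t * q z" for c x
    unfolding r_def by (rule cInf_greatest[OF ne]) (use that in \<open>auto simp: A_def\<close>)
  have add: "r (x + y) \<le> r x + r y" for x y
  proof -
    have "r (x + y) - (q (x + s t z) - t * q z) \<le> q (y + s u z) - u * q z"
      if "t \<ge> 0" "u \<ge> 0" for t u
    proof -
      have "r (x + y) \<le> q (x + y + s (t + u) z) - (t + u) * q z"
        by (rule up) (use that in simp)
      moreover have "q (x + y + s (t + u) z) \<le> q (x + s t z) + q (y + s u z)"
        using sublinear_add[OF q, of "x + s t z" "y + s u z"]
        by (simp add: scale_left_distrib algebra_simps)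
      ultimately show ?thesis by (simp add: algebra_simps)
    qed
    then have "r (x + y) - (q (x + s t z) - t * q z) \<le> r y" if "t \<ge> 0" for t
      using greatest that by blast
    then have "r (x + y) - r y \<le> q (x + s t z) - t * q z" if "t \<ge> 0" for t
      using that by (smt (verit))
    then have "r (x + y) - r y \<le> r x" using greatest by blast
    then show ?thesis by simp
  qed
  have r0: "r 0 = 0"
  proof (rule antisym)
    show "r 0 \<le> 0" using up[of 0 0] sublinear_zero[OF q] by simp
    show "0 \<le> r 0" by (rule greatest) (simp add: sublinear_scale[OF q])
  qed
  have scale_le: "r (s c x) \<le> c * r x" if "c > 0" for c x
  proof -
    have "r (s c x) / c \<le> q (x + s t z) - t * q z" if t: "t \<ge> 0" for t
    proof -
      have "r (s c x) \<le> q (s c x + s (c * t) z) - (c * t) * q z"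
        by (rule up) (use t \<open>c > 0\<close> in simp)
      also have "s c x + s (c * t) z = s c (x + s t z)"
        by (simp add: scale_right_distrib)
      also have "q (s c (x + s t z)) = c * q (x + s t z)"
        using sublinear_scale[OF q] \<open>c > 0\<close> by simp
      finally show ?thesis using \<open>c > 0\<close> by (simp add: field_simps)
    qed
    then have "r (s c x) / c \<le> r x" by (rule greatest)
    then show ?thesis using \<open>c > 0\<close> by (simp add: field_simps)
  qed
  have scale: "r (s c x) = c * r x" if "c \<ge> 0" for c x
  proof (cases "c = 0")
    case False
    then have "c > 0" using that by simp
    have "r (s (1 / c) (s c x)) \<le> 1 / c * r (s c x)"
      by (rule scale_le) (use \<open>c > 0\<close> in simp)
    then have "c * r x \<le> r (s c x)" using \<open>c > 0\<close> by (simp add: field_simps)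
    then show ?thesis using scale_le[OF \<open>c > 0\<close>, of x] by simp
  qed (simp add: r0)
  show thesis
  proof
    show "sublinear s r" using add scale by (auto simp: sublinear_def)
    show "r x \<le> q x" for x using up[of 0 x] by simp
    show "r x \<le> q (x + z) - q z" for x using up[of 1 x] by simp
  qed
qed

text \<open>
  By Zorn's lemma there is a minimal sublinear functional below \<open>q\<close>: a chain is bounded from below
  at \<open>x\<close> by \<open>- q (- x)\<close>, so its pointwise infimum exists and is again sublinear.
  Flattening shows that a minimal one is linear.
\<close>

lemma linear_below_sublinear:
  assumes q: "sublinear s q"
  obtains g where "Vector_Spaces.linear s (*) g" "\<And>x. g x \<le> q x"
proof -
  define Q where "Q = {r. sublinear s r \<and> r \<le> q}"
  define ge where "ge = (\<lambda>r r' :: 'a \<Rightarrow> real. r' \<le> r)"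
  have "\<exists>m\<in>Q. \<forall>r\<in>Q. ge m r \<longrightarrow> r = m"
  proof (rule predicate_Zorn)
    show "partial_order_on Q (relation_of ge Q)"
      by (auto simp: partial_order_on_def preorder_on_def refl_on_def trans_def antisym_def
          relation_of_def ge_def intro: order_trans order_antisym)
  next
    fix C assume C: "C \<in> Chains (relation_of ge Q)"
    show "\<exists>u\<in>Q. \<forall>r\<in>C. ge r u"
    proof (cases "C = {}")
      case True
      then show ?thesis using q by (auto simp: Q_def)
    next
      case False
      have CQ: "C \<subseteq> Q"
        using C by (auto simp: Chains_def relation_of_def)
      have sub: "sublinear s r" and below: "\<And>x. r x \<le> q x" if "r \<in> C" for r
        using CQ that by (auto simp: Q_def le_fun_def)
      have total: "r \<le> r' \<or> r' \<le> r" if "r \<in> C" "r' \<in> C" for r r'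
        using C that by (auto simp: Chains_def relation_of_def ge_def)
      define u where "u x = (INF r\<in>C. r x)" for x
      have bdd: "bdd_below ((\<lambda>r. r x) ` C)" for x
      proof (rule bdd_belowI2)
        show "- q (- x) \<le> r x" if "r \<in> C" for r
          using sublinear_minus[OF sub[OF that], of x] below[OF that, of "- x"] by linarith
      qed
      have up: "u x \<le> r x" if "r \<in> C" for r x
        unfolding u_def by (rule cINF_lower[OF bdd that])
      have greatest: "c \<le> u x" if "\<And>r. r \<in> C \<Longrightarrow> c \<le> r x" for c x
        unfolding u_def by (rule cINF_greatest[OF False that])
      have add: "u (x + y) \<le> u x + u y" for x y
      proof -
        have "u (x + y) - r x \<le> r' y" if "r \<in> C" "r' \<in> C" for r r'
        proof -
          have "\<exists>w\<in>C. w \<le> r \<and> w \<le> r'"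
            using total[OF that] that by auto
          then obtain w where w: "w \<in> C" "w \<le> r" "w \<le> r'" by blast
          then show ?thesis
            using up[OF w(1), of "x + y"] sublinear_add[OF sub[OF w(1)], of x y]
            by (auto simp: le_fun_def) (smt (verit))
        qed
        then have "u (x + y) - r x \<le> u y" if "r \<in> C" for r
          using greatest that by blast
        then have "u (x + y) - u y \<le> r x" if "r \<in> C" for r
          using that by (smt (verit))
        then have "u (x + y) - u y \<le> u x" using greatest by blast
        then show ?thesis by simp
      qed
      have scale_le: "c * u x \<le> u (s c x)" if "c \<ge> 0" for c x
      proof (rule greatest)
        fix r assume r: "r \<in> C"
        show "c * u x \<le> r (s c x)"
          using sublinear_scale[OF sub[OF r] that, of x] mult_left_mono[OF up[OF r, of x] that]
          by simp
      qed
      have scale: "u (s c x) = c * u x" if "c \<ge> 0" for c x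
      proof (cases "c = 0")
        case True
        obtain r where "r \<in> C" using False by blast
        then show ?thesis
          using scale_le[OF that, of x] up[of r 0] sublinear_zero[OF sub, of r] True by simp
      next
        case c: False
        then have "c > 0" using that by simp
        have "1 / c * u (s c x) \<le> u (s (1 / c) (s c x))"
          by (rule scale_le) (use \<open>c > 0\<close> in simp)
        then have "u (s c x) \<le> c * u x" using \<open>c > 0\<close> by (simp add: field_simps)
        then show ?thesis using scale_le[OF that, of x] by simp
      qed
      obtain r where "r \<in> C" using False by blast
      have "u x \<le> q x" for x
        using order_trans[OF up[OF \<open>r \<in> C\<close>] below[OF \<open>r \<in> C\<close>]] .
      then have "u \<in> Q"
        using add scale by (simp add: Q_def sublinear_def le_fun_def)
      moreover have "\<forall>r\<in>C. ge r u" using up by (auto simp: ge_def le_fun_def)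
      ultimately show ?thesis by blast
    qed
  qed
  then obtain m where m: "sublinear s m" "m \<le> q"
    and minimal: "\<And>r. sublinear s r \<Longrightarrow> r \<le> m \<Longrightarrow> r = m"
    unfolding Q_def ge_def by (auto intro: order_trans)
  have add: "m (x + z) = m x + m z" for x z
  proof -
    obtain r where r: "sublinear s r" "\<And>x. r x \<le> m x" "\<And>x. r x \<le> m (x + z) - m z"
      using sublinear_flatten[OF m(1)] by blast
    then have "r = m" using minimal by (simp add: le_fun_def)
    then show ?thesis
      using r(3)[of x] sublinear_add[OF m(1), of x z] by simp
  qed
  have neg: "m (- x) = - m x" for x
    using add[of x "- x"] sublinear_zero[OF m(1)] by simp
  have scale: "m (s c x) = c * m x" for c x
  proof (cases "c \<ge> 0")
    case False
    have "m (s c x) = - m (s (- c) x)" using neg[of "s c x"] by simp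
    also have "\<dots> = c * m x" using sublinear_scale[OF m(1), of "- c" x] False by simp
    finally show ?thesis .
  qed (simp add: sublinear_scale[OF m(1)])
  have "vector_space ((*) :: real \<Rightarrow> real \<Rightarrow> real)"
    by unfold_locales (auto simp: algebra_simps)
  then have "Vector_Spaces.linear s (*) m"
    using add scale vs by (auto simp: Vector_Spaces.linear_iff)
  then show thesis using that m(2) by (auto simp: le_fun_def)
qed

text \<open>
  Flattening \<open>q\<close> at \<open>y\<close> beforehand forces every linear functional below the result to agree with
  \<open>q\<close> at \<open>y\<close>.
\<close>

lemma real_norming_functional:
  assumes q: "sublinear s q"
  obtains g where "Vector_Spaces.linear s (*) g" "\<And>x. g x \<le> q x" "g y = q y"
proof -
  obtain r where r: "sublinear s r" "\<And>x. r x \<le> q x" "\<And>x. r x \<le> q (x + y) - q y"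
    using sublinear_flatten[OF q] by blast
  obtain g where g: "Vector_Spaces.linear s (*) g" "\<And>x. g x \<le> r x"
    using linear_below_sublinear[OF r(1)] by blast
  have "g (- y) \<le> - q y" using g(2)[of "- y"] r(3)[of "- y"] sublinear_zero[OF q] by simp
  moreover have "g (- y) = - g y"
    using linear_scaleD[OF g(1), of "- 1" y] by simp
  ultimately have "g y = q y" using g(2)[of y] r(2)[of y] by simp
  then show thesis using that g r(2) by (meson order_trans)
qed

end

text \<open>
  This is the only property of the scalar field, beyond being a normed field over the reals, that
  the construction of the operator relies on; it is established separately for real and for
  complex scalars.
\<close>

definition norming_functionals :: "('k::real_normed_field \<Rightarrow> 'a::ab_group_add \<Rightarrow> 'a) \<Rightarrow> bool" where
  "norming_functionals smul \<longleftrightarrow>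
     (\<forall>q y. seminorm smul q \<longrightarrow>
        (\<exists>g. Vector_Spaces.linear smul (*) g \<and> (\<forall>x. norm (g x) \<le> q x) \<and> norm (g y) = q y))"

lemma seminorm_add: "seminorm smul q \<Longrightarrow> q (x + y) \<le> q x + q y"
  and seminorm_scale: "seminorm smul q \<Longrightarrow> q (smul c x) = norm c * q x"
  by (auto simp: seminorm_def)

lemma norming_functionals_real:
  fixes smul :: "real \<Rightarrow> 'a::ab_group_add \<Rightarrow> 'a"
  assumes vs: "vector_space smul"
  shows "norming_functionals smul"
  unfolding norming_functionals_def
proof (intro allI impI)
  fix q y assume q: "seminorm smul q"
  interpret vector_space smul by (rule vs)
  have sub: "sublinear smul q" using q by (auto simp: seminorm_def sublinear_def)
  obtain g where g: "Vector_Spaces.linear smul (*) g" "\<And>x. g x \<le> q x" "g y = q y"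
    using real_norming_functional[OF vs sub] by blast
  have even: "q (- x) = q x" for x using seminorm_scale[OF q, of "- 1" x] by simp
  have "g (- x) = - g x" for x
    using linear_scaleD[OF g(1), of "- 1" x] by simp
  then have "norm (g x) \<le> q x" for x
    using g(2)[of x] g(2)[of "- x"] even[of x] by (simp add: abs_le_iff)
  moreover have "norm (g y) = q y" using calculation[of y] g(3) by simp
  ultimately show "\<exists>g. Vector_Spaces.linear smul (*) g \<and> (\<forall>x. norm (g x) \<le> q x) \<and> norm (g y) = q y"
    using g(1) by blast
qed

text \<open>
  A real-linear functional \<open>u\<close> is the real part of the complex-linear functional
  \<open>u x - i u (i x)\<close>; rotating \<open>x\<close> so that the value becomes a nonnegative real transfers the
  bound from \<open>u\<close>.
\<close>

lemma norming_functionals_complex: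
  fixes smul :: "complex \<Rightarrow> 'a::ab_group_add \<Rightarrow> 'a"
  assumes vs: "vector_space smul"
  shows "norming_functionals smul"
  unfolding norming_functionals_def
proof (intro allI impI)
  fix q y assume q: "seminorm smul q"
  interpret vector_space smul by (rule vs)
  define s where "s r = smul (of_real r)" for r
  have vs': "vector_space s"
    by unfold_locales (auto simp: s_def scale_right_distrib scale_left_distrib)
  have sub: "sublinear s q" using q by (auto simp: seminorm_def sublinear_def s_def)
  obtain u where u: "Vector_Spaces.linear s (*) u" "\<And>x. u x \<le> q x" "u y = q y"
    using real_norming_functional[OF vs' sub] by blast
  have u_add: "u (a + b) = u a + u b" for a b by (rule linear_addD[OF u(1)])
  have u_scale: "u (smul (of_real r) a) = r * u a" for a r
    using linear_scaleD[OF u(1), of r a] by (simp add: s_def)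
  define g where "g x = Complex (u x) (- u (smul \<i> x))" for x
  have g_add: "g (a + b) = g a + g b" for a b
    by (simp add: g_def u_add scale_right_distrib complex_eq_iff)
  have u_cx: "u (smul c x) = Re c * u x + Im c * u (smul \<i> x)" for c x
  proof -
    have "c = of_real (Re c) + of_real (Im c) * \<i>" by (simp add: complex_eq_iff)
    then have "smul c x = smul (of_real (Re c)) x + smul (of_real (Im c)) (smul \<i> x)"
      by (metis scale_left_distrib scale_scale)
    then have "u (smul c x) = u (smul (of_real (Re c)) x + smul (of_real (Im c)) (smul \<i> x))"
      by (rule arg_cong)
    then show ?thesis unfolding u_add u_scale .
  qed
  have u_i: "u (smul \<i> (smul c x)) = Re c * u (smul \<i> x) - Im c * u x" for c x
    unfolding scale_scale by (subst u_cx) simp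
  have g_scale: "g (smul c x) = c * g x" for c x
    unfolding g_def u_i u_cx[of c x] by (simp add: complex_eq_iff algebra_simps)
  have le: "norm (g x) \<le> q x" for x
  proof (cases "g x = 0")
    case True
    have "q 0 = 0" using seminorm_scale[OF q, of 0 0] by simp
    moreover have "q (- x) = q x" using seminorm_scale[OF q, of "- 1" x] by simp
    ultimately have "0 \<le> q x" using seminorm_add[OF q, of x "- x"] by simp
    then show ?thesis using True by simp
  next
    case False
    define c where "c = of_real (norm (g x)) / g x"
    have c: "norm c = 1" using False by (simp add: c_def norm_divide)
    have "norm (g x) = Re (g (smul c x))" using False by (simp add: g_scale c_def)
    also have "\<dots> = u (smul c x)" by (simp add: g_def)
    also have "\<dots> \<le> q (smul c x)" by (rule u(2))
    also have "\<dots> = q x" using seminorm_scale[OF q] c by simp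
    finally show ?thesis .
  qed
  have "q y \<le> norm (g y)" using complex_Re_le_cmod[of "g y"] u(3) by (simp add: g_def)
  then have "norm (g y) = q y" using le[of y] by simp
  moreover have "vector_space ((*) :: complex \<Rightarrow> complex \<Rightarrow> complex)"
    by unfold_locales (auto simp: algebra_simps)
  then have "Vector_Spaces.linear smul (*) g"
    using vs g_add g_scale by (auto simp: Vector_Spaces.linear_iff)
  ultimately show "\<exists>g. Vector_Spaces.linear smul (*) g \<and> (\<forall>x. norm (g x) \<le> q x) \<and> norm (g y) = q y"
    using le by blast
qed

section \<open>Translation of polynomials and Hermite interpolation\<close>

abbreviation translate :: "'k::comm_ring_1 \<Rightarrow> 'k poly \<Rightarrow> 'k poly" where
  "translate c P \<equiv> pcompose P [:c, 1:]"

abbreviation dilate :: "'k::comm_ring_1 \<Rightarrow> 'k poly \<Rightarrow> 'k poly" where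
  "dilate c P \<equiv> pcompose P [:0, c:]"

lemma translate_translate: "translate a (translate b P) = translate (a + b) P"
  by (simp add: pcompose_assoc[symmetric] pcompose_pCons add.commute)

lemma translate_dilate:
  fixes k :: "'k::field"
  assumes "k \<noteq> 0"
  shows "translate (c * k) (dilate (1 / k) P) = dilate (1 / k) (translate c P)"
  using assms by (simp add: pcompose_assoc[symmetric] pcompose_pCons)

lemma pcompose_power: "pcompose (P ^ n) Q = pcompose P Q ^ n"
  by (induction n) (simp_all add: pcompose_1 pcompose_mult)

lemma X_dvd_iff: "[:0, 1:] dvd P \<longleftrightarrow> poly P 0 = (0::'k::field)"
  using poly_eq_0_iff_dvd[of P 0] by simp

text \<open>
  Hermite interpolation at the nodes \<open>0, ..., m\<close> to order \<open>d\<close>: the Taylor expansion at node \<open>j\<close>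
  starts with \<open>t\<^sup>i\<close>, and the expansions at all other nodes start with zero, up to terms divisible by
  \<open>t\<^sup>d\<close>.  If \<open>L\<close> is the Lagrange polynomial of node \<open>j\<close>, then \<open>L\<^sup>d\<close> vanishes to order \<open>d\<close> at
  the other nodes, and \<open>1 - (1 - L\<^sup>d)\<^sup>d\<close> keeps these zeros while being \<open>1\<close> to order \<open>d\<close> at \<open>j\<close>.
\<close>

lemma ex_hermite_polynomial:
  fixes m d i j :: nat
  assumes j: "j \<le> m"
  obtains G :: "'k::field_char_0 poly" where
    "\<And>l. l \<le> m \<Longrightarrow>
       [:0, 1:] ^ d dvd translate (of_nat l) G - (if l = j then [:0, 1:] ^ i else 0)"
proof -
  define L :: "'k poly" where
    "L = (\<Prod>l\<in>{..m} - {j}. smult (1 / (of_nat j - of_nat l)) [:- of_nat l, 1:])"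
  define E where "E = 1 - (1 - L ^ d) ^ d"
  define G where "G = [:- of_nat j, 1:] ^ i * E"
  have L_j: "poly L (of_nat j) = 1"
    unfolding L_def poly_prod by (rule prod.neutral) (auto simp: diff_divide_distrib[symmetric])
  have L_other: "poly L (of_nat l) = 0" if "l \<le> m" "l \<noteq> j" for l
    unfolding L_def poly_prod by (rule prod_zero) (use that in auto)
  show thesis
  proof
    fix l assume l: "l \<le> m"
    define B where "B = translate (of_nat l) L"
    have B0: "poly B 0 = poly L (of_nat l)" by (simp add: B_def poly_pcompose)
    have E: "translate (of_nat l) E = 1 - (1 - B ^ d) ^ d"
      by (simp add: E_def B_def pcompose_diff pcompose_power pcompose_1)
    have G: "translate (of_nat l) G = [:of_nat l - of_nat j, 1:] ^ i * (1 - (1 - B ^ d) ^ d)"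
      by (simp add: G_def pcompose_mult pcompose_power E pcompose_pCons)
    show "[:0, 1:] ^ d dvd translate (of_nat l) G - (if l = j then [:0, 1:] ^ i else 0)"
    proof (cases "l = j")
      case True
      have "[:0, 1:] dvd 1 - B ^ d"
        unfolding X_dvd_iff using True B0 L_j by simp
      then have "[:0, 1:] ^ d dvd (1 - B ^ d) ^ d" by (rule dvd_power_same)
      moreover have "translate (of_nat l) G - [:0, 1:] ^ i = - ([:0, 1:] ^ i * (1 - B ^ d) ^ d)"
        unfolding G using True by (simp add: algebra_simps)
      ultimately show ?thesis using True by simp
    next
      case False
      have "[:0, 1:] dvd B" unfolding X_dvd_iff using False B0 L_other l by simp
      then have "[:0, 1:] ^ d dvd B ^ d" by (rule dvd_power_same)
      also have "B ^ d = 1 - (1 - B ^ d)" by simp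
      also have "\<dots> dvd 1 - (1 - B ^ d) ^ d" unfolding one_diff_power_eq by (rule dvd_triv_left)
      finally show ?thesis using False by (simp add: G)
    qed
  qed
qed

definition fdiff :: "'k::comm_ring_1 poly \<Rightarrow> 'k poly" where
  "fdiff P = translate 1 P - P"

lemma fdiff_add: "fdiff (P + Q) = fdiff P + fdiff Q"
  by (simp add: fdiff_def pcompose_add)

lemma fdiff_smult: "fdiff (smult c P) = smult c (fdiff P)"
  by (simp add: fdiff_def pcompose_smult smult_diff_right)

lemma fdiff_power_add: "(fdiff ^^ n) (P + Q) = (fdiff ^^ n) P + (fdiff ^^ n) Q"
  by (induction n) (simp_all add: fdiff_add)

lemma fdiff_power_smult: "(fdiff ^^ n) (smult c P) = smult c ((fdiff ^^ n) P)"
  by (induction n) (simp_all add: fdiff_smult)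

lemma fdiff_0 [simp]: "fdiff 0 = 0"
  by (simp add: fdiff_def)

lemma fdiff_power_0: "(fdiff ^^ n) 0 = 0"
  by (induction n) simp_all

lemma degree_fdiff:
  fixes P :: "'k::field poly"
  assumes "degree P > 0"
  shows "degree (fdiff P) < degree P"
proof -
  have deg: "degree (translate 1 P) = degree P" by (simp add: degree_pcompose)
  have "coeff (translate 1 P) (degree P) = coeff P (degree P)"
    using lead_coeff_comp[of "[:1, 1:]" P] deg by simp
  then have "coeff (fdiff P) (degree P) = 0" by (simp add: fdiff_def)
  moreover have "degree (fdiff P) \<le> degree P"
    unfolding fdiff_def by (rule degree_diff_le) (simp_all add: deg)
  ultimately show ?thesis
    using assms by (metis degree_0 leading_coeff_0_iff le_neq_implies_less)
qed

lemma fdiff_power_eq_0: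
  fixes P :: "'k::field poly"
  shows "degree P < n \<Longrightarrow> (fdiff ^^ n) P = 0"
proof (induction n arbitrary: P)
  case (Suc n)
  show ?case
  proof (cases "degree P = 0")
    case True
    then have "fdiff P = 0" by (auto simp: fdiff_def elim!: degree_eq_zeroE)
    then show ?thesis by (simp add: funpow_Suc_right fdiff_power_0 del: funpow.simps)
  next
    case False
    then have "degree (fdiff P) < n" using degree_fdiff[of P] Suc.prems by simp
    then show ?thesis using Suc.IH by (simp add: funpow_Suc_right del: funpow.simps)
  qed
qed simp

text \<open>
  The binomial polynomials \<open>t (t - 1) ... (t - l + 1) / l!\<close>.
\<close>

fun newton :: "nat \<Rightarrow> 'k::field_char_0 poly" where
  "newton 0 = 1"
| "newton (Suc l) = smult (1 / of_nat (Suc l)) (newton l * [:- of_nat l, 1:])"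

lemma newton_at_0: "poly (newton l) 0 = (if l = 0 then 1 else 0)"
proof (induction l)
  case (Suc l)
  have "poly (newton (Suc l)) 0 = 1 / of_nat (Suc l) * (poly (newton l) 0 * (- of_nat l))"
    by simp
  then show ?case using Suc.IH by (cases "l = 0") simp_all
qed simp

lemma fdiff_newton: "fdiff (newton (Suc l) :: 'k::field_char_0 poly) = newton l"
proof (induction l)
  case 0
  show ?case by (simp add: fdiff_def pcompose_pCons one_pCons)
next
  case (Suc l)
  let ?N = "newton (Suc l) :: 'k poly" and ?X = "[:- of_nat (Suc l), 1:] :: 'k poly"
  let ?c = "of_nat (Suc (Suc l)) :: 'k"
  have c: "?c \<noteq> 0" using of_nat_neq_0 by blast
  have X: "translate 1 ?X = ?X + 1" by (simp add: pcompose_pCons one_pCons)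
  have N: "translate 1 ?N = ?N + newton l"
    using Suc.IH by (simp add: fdiff_def algebra_simps del: newton.simps)
  have low: "newton l * (?X + 1) = smult (of_nat (Suc l)) ?N"
  proof -
    have "?X + 1 = [:- of_nat l, 1:]" by (simp add: one_pCons)
    moreover have "of_nat (Suc l) * (1 / of_nat (Suc l)) = (1 :: 'k)"
      using of_nat_neq_0[of l] by (simp del: of_nat_Suc)
    ultimately show ?thesis by (simp del: of_nat_Suc)
  qed
  have product_rule: "(N + M) * (X + 1) - N * X = N + M * (X + 1)" for N M X :: "'k poly"
    by (simp add: algebra_simps)
  have "translate 1 (?N * ?X) - ?N * ?X = ?N + newton l * (?X + 1)"
    unfolding pcompose_mult X N by (rule product_rule)
  also have "\<dots> = smult ?c ?N"
    unfolding low of_nat_Suc[of "Suc l"] smult_add_left by simp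
  finally have "smult ?c (fdiff (newton (Suc (Suc l)))) = smult ?c ?N"
    using c by (simp add: newton.simps(2)[of "Suc l"] fdiff_def pcompose_smult
        smult_diff_right[symmetric] del: newton.simps of_nat_Suc)
  then show ?case using c by (metis smult_smult right_inverse smult_1_left left_inverse)
qed

text \<open>
  The functionals \<open>P \<mapsto> (\<Delta>\<^sup>j P)(0)\<close> are biorthogonal to the binomial polynomials, so they
  are the coefficients in Newton's forward difference expansion.
\<close>

lemma fdiff_power_newton:
  "poly ((fdiff ^^ j) (newton l :: 'k::field_char_0 poly)) 0 = (if j = l then 1 else 0)"
proof (induction j arbitrary: l)
  case 0
  then show ?case by (simp add: newton_at_0)
next
  case (Suc j)
  show ?case
  proof (cases l)
    case 0
    have "fdiff (1 :: 'k poly) = 0" by (simp add: fdiff_def pcompose_1)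
    then show ?thesis using 0 by (simp add: funpow_Suc_right fdiff_power_0 del: funpow.simps)
  next
    case (Suc l')
    then show ?thesis using Suc.IH[of l']
      by (simp add: funpow_Suc_right fdiff_newton del: funpow.simps newton.simps)
  qed
qed

lemma dilate_as_sum: "dilate c P = (\<Sum>l\<le>degree P. smult (coeff P l * c ^ l) ([:0, 1:] ^ l))"
proof -
  have "dilate c P = pcompose (\<Sum>l\<le>degree P. smult (coeff P l) ([:0, 1:] ^ l)) [:0, c:]"
    by (subst poly_as_sum_of_monoms[of P, symmetric]) (simp add: monom_altdef)
  also have "\<dots> = (\<Sum>l\<le>degree P. smult (coeff P l) ([:0, c:] ^ l))"
    by (simp add: pcompose_sum pcompose_smult pcompose_power pcompose_pCons)
  also have "\<dots> = (\<Sum>l\<le>degree P. smult (coeff P l) (smult (c ^ l) ([:0, 1:] ^ l)))"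
    by (simp add: smult_power[symmetric])
  finally show ?thesis by simp
qed

section \<open>Frechet spaces with increasing seminorms\<close>

text \<open>
  Increasing seminorms generate the topology by single seminorm balls, and a continuous linear
  map is one for which each seminorm of the image is dominated by a multiple of a single seminorm.
\<close>

locale frechet_grading = vector_space smul
  for smul :: "'k::real_normed_field \<Rightarrow> 'a::{ab_group_add, topological_space} \<Rightarrow> 'a" +
  fixes p :: "nat \<Rightarrow> 'a \<Rightarrow> real"
  assumes seminorm_p: "seminorm smul (p n)"
    and p_mono: "m \<le> n \<Longrightarrow> p m x \<le> p n x"
    and p_separates: "(\<And>n. p n x = 0) \<Longrightarrow> x = 0"
    and open_iff: "open U \<longleftrightarrow> (\<forall>x\<in>U. \<exists>n. \<exists>e>0. {y. p n (y - x) < e} \<subseteq> U)"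
    and complete: "seminorm_Cauchy p s \<Longrightarrow> \<exists>l. \<forall>n. (\<lambda>i. p n (s i - l)) \<longlonglongrightarrow> 0"
begin

lemma p_add: "p n (x + y) \<le> p n x + p n y"
  and p_smul: "p n (smul c x) = norm c * p n x"
  using seminorm_p by (auto simp: seminorm_def)

lemma p_0 [simp]: "p n 0 = 0"
  using p_smul[of n 0 0] by simp

lemma p_uminus [simp]: "p n (- x) = p n x"
  using p_smul[of n "- 1" x] by simp

lemma p_nonneg [simp]: "0 \<le> p n x"
  using p_add[of n x "- x"] by simp

lemma p_diff: "p n (x - y) \<le> p n x + p n y"
  using p_add[of n x "- y"] by simp

lemma p_diff_commute: "p n (x - y) = p n (y - x)"
  using p_uminus[of n "x - y"] by simp

lemma p_triangle: "p n (x - z) \<le> p n (x - y) + p n (y - z)"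
  using p_add[of n "x - y" "y - z"] by simp

lemma p_sum: "p n (sum h I) \<le> (\<Sum>i\<in>I. p n (h i))"
proof (induction I rule: infinite_finite_induct)
  case (insert i I)
  then show ?case using p_add[of n "h i" "sum h I"] by simp
qed simp_all

lemma open_ball: "open {y. p n (y - x) < e}"
  unfolding open_iff
proof
  fix y assume y: "y \<in> {y. p n (y - x) < e}"
  have "{w. p n (w - y) < e - p n (y - x)} \<subseteq> {y. p n (y - x) < e}"
    using p_triangle[of n _ x y] by (auto simp: less_diff_eq intro: le_less_trans)
  then show "\<exists>m. \<exists>e'>0. {w. p m (w - y) < e'} \<subseteq> {y. p n (y - x) < e}"
    using y by (intro exI[of _ n] exI[of _ "e - p n (y - x)"]) auto
qed

lemma ex_ball_in_open:
  assumes "open U" "x \<in> U"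
  shows "\<exists>n. \<exists>e>0. \<forall>y. p n (y - x) < e \<longrightarrow> y \<in> U"
  using assms unfolding open_iff[of U] by (auto simp: subset_iff)

text \<open>
  Convergence is expressed by the seminorms, because the type of vectors carries no type class that
  relates its topology to addition.
\<close>

definition tends_to :: "(nat \<Rightarrow> 'a) \<Rightarrow> 'a \<Rightarrow> bool" where
  "tends_to s l \<longleftrightarrow> (\<forall>n. (\<lambda>i. p n (s i - l)) \<longlonglongrightarrow> 0)"

lemma tends_to_unique:
  assumes "tends_to s l" "tends_to s l'"
  shows "l = l'"
proof -
  have "p n (l - l') = 0" for n
  proof -
    have "(\<lambda>i. p n (s i - l) + p n (s i - l')) \<longlonglongrightarrow> 0 + 0"
      using assms unfolding tends_to_def by (intro tendsto_add) blast+
    moreover have "p n (l - l') \<le> p n (s i - l) + p n (s i - l')" for i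
      using p_triangle[of n l l' "s i"] p_diff_commute[of n l "s i"] by simp
    ultimately have "p n (l - l') \<le> 0" by (intro LIMSEQ_le_const) auto
    then show ?thesis by (simp add: antisym)
  qed
  then show ?thesis using p_separates[of "l - l'"] by simp
qed

lemma p_squeeze:
  assumes "\<And>i. p n (s i) \<le> b i" "b \<longlonglongrightarrow> 0"
  shows "(\<lambda>i. p n (s i)) \<longlonglongrightarrow> 0"
  by (rule Lim_null_comparison[OF _ assms(2)]) (simp add: assms(1))

lemma tends_to_add:
  assumes "tends_to s l" "tends_to s' l'"
  shows "tends_to (\<lambda>i. s i + s' i) (l + l')"
  unfolding tends_to_def
proof
  fix n
  have "(\<lambda>i. p n (s i - l) + p n (s' i - l')) \<longlonglongrightarrow> 0 + 0"
    using assms unfolding tends_to_def by (intro tendsto_add) blast+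
  moreover have "p n (s i + s' i - (l + l')) \<le> p n (s i - l) + p n (s' i - l')" for i
    using p_add[of n "s i - l" "s' i - l'"] by (simp add: add_diff_add)
  ultimately show "(\<lambda>i. p n (s i + s' i - (l + l'))) \<longlonglongrightarrow> 0"
    by (intro p_squeeze[where b = "\<lambda>i. p n (s i - l) + p n (s' i - l')"]) simp_all
qed

lemma tends_to_smul:
  assumes "tends_to s l"
  shows "tends_to (\<lambda>i. smul c (s i)) (smul c l)"
  unfolding tends_to_def
proof
  fix n
  have "(\<lambda>i. norm c * p n (s i - l)) \<longlonglongrightarrow> norm c * 0"
    using assms unfolding tends_to_def by (intro tendsto_mult_left) auto
  then show "(\<lambda>i. p n (smul c (s i) - smul c l)) \<longlonglongrightarrow> 0"
    by (simp add: p_smul scale_right_diff_distrib[symmetric])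
qed

lemma series_tends_to:
  assumes summable: "\<And>n. summable (\<lambda>i. p n (y i))"
  shows "\<exists>l. tends_to (\<lambda>N. \<Sum>i<N. y i) l"
proof -
  let ?s = "\<lambda>N. \<Sum>i<N. y i"
  have "seminorm_Cauchy p ?s"
    unfolding seminorm_Cauchy_def
  proof (intro allI impI)
    fix n and e :: real assume "e > 0"
    have "Cauchy (\<lambda>N. \<Sum>i<N. p n (y i))"
      using summable[of n] by (simp add: summable_iff_convergent Cauchy_convergent_iff)
    then obtain N where N: "\<And>i j. i \<ge> N \<Longrightarrow> j \<ge> N \<Longrightarrow>
        \<bar>(\<Sum>l<i. p n (y l)) - (\<Sum>l<j. p n (y l))\<bar> < e"
      using \<open>e > 0\<close> unfolding Cauchy_def dist_real_def by blast
    have block: "p n (?s j - ?s i) \<le> (\<Sum>l<j. p n (y l)) - (\<Sum>l<i. p n (y l))" if "i \<le> j" for i j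
    proof -
      have sub: "{..<i} \<subseteq> {..<j}" using that by auto
      show ?thesis
        using p_sum[of n y "{..<j} - {..<i}"] unfolding sum_diff[OF finite_lessThan sub] .
    qed
    have "p n (?s i - ?s j) < e" if "i \<ge> N" "j \<ge> N" for i j
    proof (cases "i \<le> j")
      case True
      then show ?thesis using block[of i j] N[OF that] p_diff_commute[of n "?s i" "?s j"] by linarith
    next
      case False
      then show ?thesis using block[of j i] N[OF that] by linarith
    qed
    then show "\<exists>N. \<forall>i\<ge>N. \<forall>j\<ge>N. p n (?s i - ?s j) < e" by blast
  qed
  then show ?thesis unfolding tends_to_def by (rule complete)
qed

lemma p_series_le:
  assumes lim: "tends_to (\<lambda>N. \<Sum>i<N. y i) l"
    and le: "\<And>i. p n (y i) \<le> b i" and b: "summable b"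
  shows "p n l \<le> suminf b"
proof -
  have "p n l \<le> p n ((\<Sum>i<N. y i) - l) + suminf b" for N
  proof -
    have "(\<Sum>i<N. p n (y i)) \<le> (\<Sum>i<N. b i)" by (rule sum_mono) (rule le)
    also have "\<dots> \<le> suminf b"
      by (rule sum_le_suminf[OF b]) (use le p_nonneg order_trans in blast)+
    finally have "p n (\<Sum>i<N. y i) \<le> suminf b" using p_sum[of n y "{..<N}"] by linarith
    then show ?thesis
      using p_triangle[of n l 0 "\<Sum>i<N. y i"] p_diff_commute[of n l "\<Sum>i<N. y i"] by simp
  qed
  moreover have "(\<lambda>N. p n ((\<Sum>i<N. y i) - l) + suminf b) \<longlonglongrightarrow> 0 + suminf b"
    using lim unfolding tends_to_def by (intro tendsto_add tendsto_const) auto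
  ultimately show ?thesis by (intro LIMSEQ_le_const) auto
qed

lemma linear_smulI:
  assumes "\<And>u v. T (u + v) = T u + T v" "\<And>c v. T (smul c v) = smul c (T v)"
  shows "Vector_Spaces.linear smul smul T"
  unfolding Vector_Spaces.linear_iff using assms vector_space_axioms by blast

text \<open>
  A series of rank-one operators converges, and defines a continuous operator, as soon as it
  converges absolutely in each target seminorm, uniformly with respect to one source seminorm.
\<close>

lemma nuclear_operator:
  assumes lin: "\<And>i. Vector_Spaces.linear smul (*) (f i)"
    and bound: "\<And>n. \<exists>r b. summable b \<and> (\<forall>i v. p n (x i) * norm (f i v) \<le> b i * p r v)"
  obtains S where "Vector_Spaces.linear smul smul S"
    "\<forall>n. \<exists>r C. \<forall>v. p n (S v) \<le> C * p r v"
    "\<forall>v. tends_to (\<lambda>N. \<Sum>i<N. smul (f i v) (x i)) (S v)"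
proof -
  have "\<exists>l. tends_to (\<lambda>N. \<Sum>i<N. smul (f i v) (x i)) l" for v
  proof -
    have "summable (\<lambda>i. p n (smul (f i v) (x i)))" for n
    proof -
      obtain r b where b: "summable b" "\<And>i v. p n (x i) * norm (f i v) \<le> b i * p r v"
        using bound[of n] by blast
      have le: "norm (p n (smul (f i v) (x i))) \<le> b i * p r v" for i
        using b(2)[of i v] by (simp add: p_smul mult.commute[of "norm (f i v)"])
      show ?thesis
        by (rule summable_comparison_test'[OF summable_mult2[OF b(1)]]) (rule le)
    qed
    then show ?thesis by (rule series_tends_to)
  qed
  then obtain S where S: "tends_to (\<lambda>N. \<Sum>i<N. smul (f i v) (x i)) (S v)" for v
    by metis
  have add: "S (u + v) = S u + S v" for u v
  proof (rule tends_to_unique[OF S])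
    show "tends_to (\<lambda>N. \<Sum>i<N. smul (f i (u + v)) (x i)) (S u + S v)"
      using tends_to_add[OF S S, of u v]
      by (simp add: linear_addD[OF lin] scale_left_distrib sum.distrib)
  qed
  have scale: "S (smul c v) = smul c (S v)" for c v
  proof (rule tends_to_unique[OF S])
    show "tends_to (\<lambda>N. \<Sum>i<N. smul (f i (smul c v)) (x i)) (smul c (S v))"
      using tends_to_smul[OF S, of c v]
      by (simp add: linear_scaleD[OF lin] scale_sum_right)
  qed
  show thesis
  proof (rule that; (intro allI)?)
    show "Vector_Spaces.linear smul smul S" by (rule linear_smulI[OF add scale])
    show "tends_to (\<lambda>N. \<Sum>i<N. smul (f i v) (x i)) (S v)" for v by (rule S)
    fix n
    obtain r b where b: "summable b" "\<And>i v. p n (x i) * norm (f i v) \<le> b i * p r v"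
      using bound[of n] by blast
    have "p n (S v) \<le> suminf b * p r v" for v
    proof -
      have "p n (S v) \<le> (\<Sum>i. b i * p r v)"
      proof (rule p_series_le[OF S])
        show "p n (smul (f i v) (x i)) \<le> b i * p r v" for i
          using b(2)[of i v] by (simp add: p_smul mult.commute[of "norm (f i v)"])
        show "summable (\<lambda>i. b i * p r v)" by (rule summable_mult2[OF b(1)])
      qed
      then show ?thesis using suminf_mult2[OF b(1), of "p r v"] by simp
    qed
    then show "\<exists>r C. \<forall>v. p n (S v) \<le> C * p r v" by blast
  qed
qed

lemma continuous_linearI:
  assumes lin: "Vector_Spaces.linear smul smul T"
    and bound: "\<And>n. \<exists>r C. \<forall>v. p n (T v) \<le> C * p r v"
  shows "continuous_on UNIV T"
proof -
  have "open (T -` U)" if "open U" for U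
    unfolding open_iff[of "T -` U"]
  proof
    fix v assume "v \<in> T -` U"
    then have "T v \<in> U" by simp
    from ex_ball_in_open[OF \<open>open U\<close> this]
    obtain n e where e: "e > 0" "\<forall>y. p n (y - T v) < e \<longrightarrow> y \<in> U"
      by (elim exE conjE)
    from bound[of n] obtain r C where C: "\<forall>v. p n (T v) \<le> C * p r v" by (elim exE)
    define d where "d = e / (\<bar>C\<bar> + 1)"
    have "d > 0" using e(1) by (simp add: d_def)
    moreover have "w \<in> T -` U" if w: "p r (w - v) < d" for w
    proof -
      have "T (w - v) = T w - T v" using linear_addD[OF lin, of "w - v" v] by simp
      then have "p n (T w - T v) \<le> C * p r (w - v)" using C by metis
      also have "\<dots> \<le> (\<bar>C\<bar> + 1) * p r (w - v)" by (rule mult_right_mono) auto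
      also have "\<dots> < (\<bar>C\<bar> + 1) * d" by (rule mult_strict_left_mono[OF w]) simp
      also have "\<dots> = e" by (simp add: d_def)
      finally show ?thesis using e(2) by simp
    qed
    ultimately show "\<exists>n. \<exists>e>0. {y. p n (y - v) < e} \<subseteq> T -` U" by blast
  qed
  then show ?thesis unfolding continuous_on_open_vimage[OF open_UNIV] by simp
qed

end

text \<open>
  Partial sums turn an arbitrary sequence of seminorms into an increasing one without changing the
  topology or the Cauchy sequences.
\<close>

lemma (in frechet_space) ex_grading:
  obtains p where "frechet_grading smul p"
proof -
  obtain q :: "nat \<Rightarrow> 'a \<Rightarrow> real" where
    q: "(\<forall>n. seminorm smul (q n)) \<and> (\<forall>x. (\<forall>n. q n x = 0) \<longrightarrow> x = 0) \<and>
        generates_topology q \<and> (\<forall>s. seminorm_Cauchy q s \<longrightarrow> (\<exists>l. s \<longlonglongrightarrow> l))"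
    using frechet_seminorms by (elim exE)
  have sn: "seminorm smul (q n)" for n using q by simp
  have sep: "x = 0" if "\<forall>n. q n x = 0" for x using q that by simp
  have gen: "generates_topology q" using q by simp
  have compl: "\<exists>l. s \<longlonglongrightarrow> l" if "seminorm_Cauchy q s" for s using q that by simp
  define p where "p n x = (\<Sum>i\<le>n. q i x)" for n x
  have q0: "q i 0 = 0" for i using seminorm_scale[OF sn, of i 0 0] by simp
  have qneg: "q i (- x) = q i x" for i x using seminorm_scale[OF sn, of i "- 1" x] by simp
  have nonneg: "0 \<le> q i x" for i x
    using seminorm_add[OF sn, of i x "- x"] by (simp add: q0 qneg)
  have q_le_p: "q i x \<le> p n x" if "i \<le> n" for i n x
    unfolding p_def by (rule member_le_sum) (use that nonneg in auto)
  have p_small: "p n x < e" if "\<And>i. i \<le> n \<Longrightarrow> q i x < e / real (Suc n)" for n x e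
  proof -
    have "p n x < (\<Sum>i\<le>n. e / real (Suc n))"
      unfolding p_def by (rule sum_strict_mono) (use that in auto)
    also have "\<dots> = e" by simp
    finally show ?thesis .
  qed
  have seminorm: "seminorm smul (p n)" for n
    unfolding seminorm_def
  proof (intro conjI allI)
    show "p n (x + y) \<le> p n x + p n y" for x y
      unfolding p_def sum.distrib[symmetric] by (rule sum_mono) (rule seminorm_add[OF sn])
    show "p n (smul c x) = norm c * p n x" for c x
      unfolding p_def sum_distrib_left by (rule sum.cong) (auto simp: seminorm_scale[OF sn])
  qed
  have open_iff: "open U \<longleftrightarrow> (\<forall>x\<in>U. \<exists>n. \<exists>e>0. {y. p n (y - x) < e} \<subseteq> U)" for U
  proof -
    have "(\<exists>e>0. {y. \<forall>i\<le>n. q i (y - x) < e} \<subseteq> U) \<longleftrightarrow> (\<exists>e>0. {y. p n (y - x) < e} \<subseteq> U)" for n x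
    proof
      assume "\<exists>e>0. {y. \<forall>i\<le>n. q i (y - x) < e} \<subseteq> U"
      then obtain e where "e > 0" "{y. \<forall>i\<le>n. q i (y - x) < e} \<subseteq> U" by blast
      moreover have "{y. p n (y - x) < e} \<subseteq> {y. \<forall>i\<le>n. q i (y - x) < e}"
        by (auto intro: le_less_trans[OF q_le_p])
      ultimately show "\<exists>e>0. {y. p n (y - x) < e} \<subseteq> U" by blast
    next
      assume "\<exists>e>0. {y. p n (y - x) < e} \<subseteq> U"
      then obtain e where "e > 0" "{y. p n (y - x) < e} \<subseteq> U" by blast
      moreover have "{y. \<forall>i\<le>n. q i (y - x) < e / real (Suc n)} \<subseteq> {y. p n (y - x) < e}"
        by (auto intro: p_small simp del: of_nat_Suc)
      ultimately have "{y. \<forall>i\<le>n. q i (y - x) < e / real (Suc n)} \<subseteq> U" by blast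
      moreover have "e / real (Suc n) > 0" using \<open>e > 0\<close> by simp
      ultimately show "\<exists>e>0. {y. \<forall>i\<le>n. q i (y - x) < e} \<subseteq> U" by blast
    qed
    then show ?thesis using gen[unfolded generates_topology_def, rule_format, of U] by simp
  qed
  have open_ball: "open {y. q n (y - x) < e}" for n x e
  proof -
    have "\<exists>m. \<exists>d>0. {w. \<forall>i\<le>m. q i (w - y) < d} \<subseteq> {y. q n (y - x) < e}"
      if y: "y \<in> {y. q n (y - x) < e}" for y
    proof (intro exI conjI)
      show "0 < e - q n (y - x)" using y by simp
      have "q n (w - x) < e" if "q n (w - y) < e - q n (y - x)" for w
        using seminorm_add[OF sn, of n "w - y" "y - x"] that by simp
      then show "{w. \<forall>i\<le>n. q i (w - y) < e - q n (y - x)} \<subseteq> {y. q n (y - x) < e}" by auto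
    qed
    then show ?thesis unfolding gen[unfolded generates_topology_def, rule_format] by (rule ballI)
  qed
  have "frechet_grading smul p"
  proof unfold_locales
    show "seminorm smul (p n)" for n by (rule seminorm)
    show "p m x \<le> p n x" if "m \<le> n" for m n x
      unfolding p_def by (rule sum_mono2) (use that nonneg in auto)
    show "x = 0" if p0: "\<And>n. p n x = 0" for x
    proof (rule sep, rule allI)
      show "q n x = 0" for n using q_le_p[of n n x] p0[of n] nonneg[of n x] by simp
    qed
    show "open U \<longleftrightarrow> (\<forall>x\<in>U. \<exists>n. \<exists>e>0. {y. p n (y - x) < e} \<subseteq> U)" for U
      by (rule open_iff)
    fix s assume "seminorm_Cauchy p s"
    have "seminorm_Cauchy q s"
      unfolding seminorm_Cauchy_def
    proof (intro allI impI)
      fix n and e :: real assume "e > 0"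
      then obtain N where "\<forall>i\<ge>N. \<forall>j\<ge>N. p n (s i - s j) < e"
        using \<open>seminorm_Cauchy p s\<close> unfolding seminorm_Cauchy_def by blast
      then show "\<exists>N. \<forall>i\<ge>N. \<forall>j\<ge>N. q n (s i - s j) < e"
        by (auto intro!: exI[of _ N] intro: le_less_trans[OF q_le_p[OF order_refl]])
    qed
    from compl[OF this] obtain l where l: "s \<longlonglongrightarrow> l" ..
    have "(\<lambda>i. q n (s i - l)) \<longlonglongrightarrow> 0" for n
    proof (rule LIMSEQ_I)
      fix e :: real assume "e > 0"
      then have "\<forall>\<^sub>F i in sequentially. s i \<in> {y. q n (y - l) < e}"
        using topological_tendstoD[OF l open_ball] by (simp add: q0)
      then show "\<exists>N. \<forall>i\<ge>N. norm (q n (s i - l) - 0) < e"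
        using nonneg by (simp add: eventually_sequentially)
    qed
    then have "(\<lambda>i. p n (s i - l)) \<longlonglongrightarrow> 0" for n
      unfolding p_def by (intro tendsto_null_sum) auto
    then show "\<exists>l. \<forall>n. (\<lambda>i. p n (s i - l)) \<longlonglongrightarrow> 0" by blast
  qed
  then show thesis by (rule that)
qed

section \<open>Biorthogonal sequences with dense span\<close>

context frechet_grading
begin

text \<open>
  The bound in the conclusion is what makes \<open>\<Sum>\<^sub>l f\<^sub>l\<^sub>+\<^sub>1 \<otimes> x\<^sub>l\<close> a continuous operator.
  Vectors and functionals are chosen recursively.  Given the first \<open>n\<close> of them, let \<open>\<pi>\<^sub>n\<close> be the
  projection that kills \<open>x\<^sub>0, ..., x\<^sub>n\<^sub>-\<^sub>1\<close>, and let \<open>\<lambda>\<^sub>n\<close> be the least level whose seminorm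
  does not vanish on the range of \<open>\<pi>\<^sub>n\<close>.  Then \<open>x\<^sub>n\<close> is a multiple of \<open>\<pi>\<^sub>n a\<close> for some \<open>a\<close>
  near a prescribed point of a dense sequence, and \<open>f\<^sub>n\<close> is a multiple of \<open>g \<circ> \<pi>\<^sub>n\<close> with \<open>g\<close> a
  norming functional for the seminorm of level \<open>\<lambda>\<^sub>n\<close>.  So all seminorms below that level vanish at
  \<open>x\<^sub>n\<close>, while \<open>f\<^sub>n\<close> is bounded by the seminorm of that level, by a constant that can be made
  small by scaling \<open>x\<^sub>n\<close> up and \<open>f\<^sub>n\<close> down.

  The levels never decrease.  If they are bounded, one seminorm bounds all the functionals.  If
  they are unbounded, as in the space of all scalar sequences, each fixed seminorm vanishes at all
  but finitely many \<open>x\<^sub>n\<close>.  In both cases the bound follows, so the two kinds of spaces need no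
  separate treatment.
\<close>

lemma ex_biorthogonal_sequence:
  fixes z :: "nat \<Rightarrow> 'a"
  assumes norming: "norming_functionals smul"
    and infdim: "\<And>B. finite B \<Longrightarrow> span B \<noteq> UNIV"
    and dense: "\<And>v n e. e > 0 \<Longrightarrow> \<exists>i. p n (z i - v) < e"
  obtains x :: "nat \<Rightarrow> 'a" and f :: "nat \<Rightarrow> 'a \<Rightarrow> 'k" where
    "\<forall>i. Vector_Spaces.linear smul (*) (f i)"
    "\<forall>i j. f i (x j) = (if i = j then 1 else 0)"
    "\<forall>v n e. e > 0 \<longrightarrow> (\<exists>w\<in>span (range x). p n (w - v) < e)"
    "\<forall>n. \<exists>r b. summable b \<and> (\<forall>i v. p n (x i) * norm (f (Suc i) v) \<le> b i * p r v)"
proof -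
  define proj where "proj h n v = v - (\<Sum>i<n. smul (snd (h i) v) (fst (h i)))"
    for h :: "nat \<Rightarrow> 'a \<times> ('a \<Rightarrow> 'k)" and n v
  define lev where "lev h n = (LEAST m. \<exists>a. p m (proj h n a) \<noteq> 0)" for h n
  (* The value of a history h at i is the pair of the i-th vector and the i-th functional.
     The target z (fst (prod_decode n)) runs through each member of the dense sequence infinitely
     often, and hence with arbitrarily good accuracy. *)
  define good where "good h n s \<longleftrightarrow> (case s of (x, f) \<Rightarrow>
      Vector_Spaces.linear smul (*) f \<and> f x = 1 \<and>
      (\<forall>i<n. f (fst (h i)) = 0 \<and> snd (h i) x = 0) \<and>
      (\<forall>m<lev h n. p m x = 0) \<and>
      (\<exists>C. \<forall>v. norm (f v) \<le> C * p (lev h n) v) \<and>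
      (\<forall>l v. n = Suc l \<longrightarrow> (1 + p l (fst (h l))) * norm (f v) \<le> (1 / 2) ^ l * p (lev h n) v) \<and>
      (\<exists>a\<in>span (insert x (fst ` h ` {..<n})).
         p n (a - z (fst (prod_decode n))) < 1 / real (Suc n)))" for h n s
  have proj_cong: "proj h n = proj h' n" if "\<And>i. i < n \<Longrightarrow> h i = h' i" for h h' n
    using that by (simp add: proj_def fun_eq_iff)
  have lev_cong: "lev h n = lev h' n" if "\<And>i. i < n \<Longrightarrow> h i = h' i" for h h' n
    by (simp add: lev_def proj_cong[of n h h', OF that])
  have good_cong: "good h n s = good h' n s" if "\<And>i. i < n \<Longrightarrow> h i = h' i" for h h' n s
  proof -
    have "lev h n = lev h' n" by (rule lev_cong) (rule that)
    moreover have "h ` {..<n} = h' ` {..<n}" using that by auto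
    ultimately show ?thesis unfolding good_def using that by (auto split: prod.splits)
  qed
  have biorth: "snd (h i) (fst (h j)) = (if i = j then 1 else 0)"
    if "\<And>l. l < n \<Longrightarrow> good h l (h l)" "i < n" "j < n" for h n i j
    using that(1)[OF that(2)] that(1)[OF that(3)]
    by (cases i j rule: linorder_cases) (auto simp: good_def split: prod.splits)
  have lin: "Vector_Spaces.linear smul (*) (snd (h i))" if "good h i (h i)" for h i
    using that by (auto simp: good_def split: prod.splits)
  have proj_add: "proj h n (u + v) = proj h n u + proj h n v"
    if "\<And>l. l < n \<Longrightarrow> good h l (h l)" for h n u v
  proof -
    have "(\<Sum>i<n. smul (snd (h i) (u + v)) (fst (h i))) =
        (\<Sum>i<n. smul (snd (h i) u) (fst (h i)) + smul (snd (h i) v) (fst (h i)))"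
      by (rule sum.cong) (simp_all add: linear_addD[OF lin[OF that]] scale_left_distrib)
    then show ?thesis by (simp add: proj_def sum.distrib)
  qed
  have proj_smul: "proj h n (smul c v) = smul c (proj h n v)"
    if "\<And>l. l < n \<Longrightarrow> good h l (h l)" for h n c v
  proof -
    have "(\<Sum>i<n. smul (snd (h i) (smul c v)) (fst (h i))) =
        (\<Sum>i<n. smul c (smul (snd (h i) v) (fst (h i))))"
      by (rule sum.cong) (simp_all add: linear_scaleD[OF lin[OF that]])
    then show ?thesis by (simp add: proj_def scale_sum_right scale_right_diff_distrib)
  qed
  have coord_proj: "snd (h j) (proj h n v) = 0"
    if good: "\<And>l. l < n \<Longrightarrow> good h l (h l)" and j: "j < n" for h n j v
  proof -
    interpret f: Vector_Spaces.linear smul "(*)" "snd (h j)" by (rule lin[OF good[OF j]])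
    have "snd (h j) (proj h n v) = snd (h j) v - (\<Sum>i<n. snd (h i) v * snd (h j) (fst (h i)))"
      by (simp add: proj_def f.diff f.sum f.scale)
    also have "(\<Sum>i<n. snd (h i) v * snd (h j) (fst (h i))) = (\<Sum>i<n. if j = i then snd (h i) v else 0)"
      by (rule sum.cong) (simp_all add: biorth[OF good j])
    also have "\<dots> = snd (h j) v" using j by simp
    finally show ?thesis by simp
  qed
  have proj_fix: "proj h n v = v" if "\<And>j. j < n \<Longrightarrow> snd (h j) v = 0" for h n v
    using that by (simp add: proj_def)
  have proj_vec: "proj h n (fst (h j)) = 0"
    if good: "\<And>l. l < n \<Longrightarrow> good h l (h l)" and j: "j < n" for h n j
  proof -
    have "(\<Sum>i<n. smul (snd (h i) (fst (h j))) (fst (h i))) = (\<Sum>i<n. if j = i then fst (h i) else 0)"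
      by (rule sum.cong) (simp_all add: biorth[OF good _ j])
    then show ?thesis using j by (simp add: proj_def)
  qed
  have proj_nonzero: "\<exists>m a. p m (proj h n a) \<noteq> 0" for h n
  proof (rule ccontr)
    assume "\<nexists>m a. p m (proj h n a) \<noteq> 0"
    then have "proj h n a = 0" for a using p_separates by blast
    then have "a = (\<Sum>i<n. smul (snd (h i) a) (fst (h i)))" for a by (simp add: proj_def)
    moreover have "(\<Sum>i<n. smul (snd (h i) a) (fst (h i))) \<in> span (fst ` h ` {..<n})" for a
      by (intro span_sum span_scale span_base) auto
    ultimately have "a \<in> span (fst ` h ` {..<n})" for a by metis
    then show False using infdim[of "fst ` h ` {..<n}"] by auto
  qed
  have lev_attained: "\<exists>a. p (lev h n) (proj h n a) \<noteq> 0" for h n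
    unfolding lev_def by (rule LeastI_ex) (rule proj_nonzero)
  have below_lev: "p m (proj h n a) = 0" if "m < lev h n" for h n m a
    using not_less_Least[OF that[unfolded lev_def]] by blast
  have lev_mono: "lev h i \<le> lev h n"
    if good: "\<And>l. l < n \<Longrightarrow> good h l (h l)" and i: "i \<le> n" for h i n
  proof -
    obtain a where a: "p (lev h n) (proj h n a) \<noteq> 0" using lev_attained by blast
    have "proj h i (proj h n a) = proj h n a"
      by (rule proj_fix) (use coord_proj[OF good] i in auto)
    then have "\<exists>b. p (lev h n) (proj h i b) \<noteq> 0" using a by metis
    then show ?thesis unfolding lev_def[of h i] by (rule Least_le)
  qed
  have step: "\<exists>s. good h n s" if good: "\<And>l. l < n \<Longrightarrow> good h l (h l)" for h n
  proof -
    define m where "m = lev h n"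
    define w where "w = z (fst (prod_decode n))"
    obtain a0 where a0: "p m (proj h n a0) \<noteq> 0" using lev_attained[of h n] m_def by blast
    (* The dense point w itself may be killed; a small multiple of a0 is then added. *)
    obtain a where a: "p m (proj h n a) \<noteq> 0" "p n (a - w) < 1 / real (Suc n)"
    proof (cases "p m (proj h n w) = 0")
      case False
      then show thesis by (intro that[of w]) auto
    next
      case True
      define t where "t = 1 / (real (Suc n) * (p n a0 + 1))"
      have t: "t > 0" by (simp add: t_def add_nonneg_pos)
      define a where "a = smul (of_real t) a0 + w"
      have "t * p n a0 < t * (p n a0 + 1)" using t by simp
      also have "\<dots> = 1 / real (Suc n)"
        using add_nonneg_pos[OF p_nonneg[of n a0] zero_less_one] by (simp add: t_def)
      finally have "p n (a - w) < 1 / real (Suc n)" using t by (simp add: a_def p_smul)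
      moreover have "t * p m (proj h n a0) \<le> p m (proj h n a)"
      proof -
        have "smul (of_real t) (proj h n a0) = proj h n a - proj h n w"
          by (simp add: a_def proj_add[OF good] proj_smul[OF good])
        then show ?thesis using p_diff[of m "proj h n a" "proj h n w"] True t
          by (metis add.right_neutral abs_of_pos norm_of_real p_smul)
      qed
      moreover have "t * p m (proj h n a0) > 0"
        using t a0 p_nonneg[of m "proj h n a0"] by (simp add: less_le)
      ultimately show thesis by (intro that[of a]) auto
    qed
    define y where "y = proj h n a"
    have y_fix: "proj h n y = y"
      unfolding y_def by (rule proj_fix) (rule coord_proj[OF good])
    obtain g where g: "Vector_Spaces.linear smul (*) g" "\<And>v. norm (g v) \<le> p m v"
        "norm (g y) = p m y"
      using norming seminorm_p[of m] unfolding norming_functionals_def by metis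
    have gy: "g y \<noteq> 0" using g(3) a(1) by (auto simp: y_def)
    have "\<exists>C. \<forall>i<n. \<forall>v. norm (snd (h i) v) \<le> C i * p m v"
    proof -
      have "\<exists>C. \<forall>v. norm (snd (h i) v) \<le> C * p m v" if i: "i < n" for i
      proof -
        obtain C where C: "\<forall>v. norm (snd (h i) v) \<le> C * p (lev h i) v"
          using good[OF i] by (auto simp: good_def split: prod.splits)
        have "norm (snd (h i) v) \<le> \<bar>C\<bar> * p m v" for v
        proof -
          have "C * p (lev h i) v \<le> \<bar>C\<bar> * p (lev h i) v" by (rule mult_right_mono) auto
          also have "\<dots> \<le> \<bar>C\<bar> * p m v"
            unfolding m_def by (rule mult_left_mono[OF p_mono[OF lev_mono[OF good]]]) (use i in auto)
          finally show ?thesis using C order_trans by blast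
        qed
        then show ?thesis by blast
      qed
      then show ?thesis by metis
    qed
    then obtain C where C: "\<And>i v. i < n \<Longrightarrow> norm (snd (h i) v) \<le> C i * p m v" by blast
    define K where "K = 1 + (\<Sum>i<n. \<bar>C i\<bar> * p m (fst (h i)))"
    have K: "K > 0" unfolding K_def by (intro add_pos_nonneg sum_nonneg) auto
    have proj_le: "p m (proj h n v) \<le> K * p m v" for v
    proof -
      have "p m (proj h n v) \<le> p m v + (\<Sum>i<n. norm (snd (h i) v) * p m (fst (h i)))"
        using p_diff[of m v "\<Sum>i<n. smul (snd (h i) v) (fst (h i))"]
          p_sum[of m "\<lambda>i. smul (snd (h i) v) (fst (h i))" "{..<n}"]
        by (simp add: proj_def p_smul)
      also have "(\<Sum>i<n. norm (snd (h i) v) * p m (fst (h i))) \<le>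
          (\<Sum>i<n. \<bar>C i\<bar> * p m (fst (h i)) * p m v)"
      proof (rule sum_mono)
        fix i assume "i \<in> {..<n}"
        then have "norm (snd (h i) v) \<le> C i * p m v" using C by simp
        also have "\<dots> \<le> \<bar>C i\<bar> * p m v" by (rule mult_right_mono) auto
        finally have "norm (snd (h i) v) * p m (fst (h i)) \<le> \<bar>C i\<bar> * p m v * p m (fst (h i))"
          by (rule mult_right_mono) simp
        then show "norm (snd (h i) v) * p m (fst (h i)) \<le> \<bar>C i\<bar> * p m (fst (h i)) * p m v"
          by (simp add: mult.assoc mult.commute[of "p m v"])
      qed
      finally show ?thesis by (simp add: K_def sum_distrib_right distrib_right)
    qed
    (* For n = 0 the predecessor n - 1 is 0 and the resulting factor is harmless. *)
    define D where "D = K * (1 + p (n - 1) (fst (h (n - 1))))"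
    have D: "D > 0" unfolding D_def using K by (intro mult_pos_pos add_pos_nonneg) auto
    define c :: 'k where "c = of_real ((1 / 2) ^ (n - 1) / D)"
    have c: "norm c = (1 / 2) ^ (n - 1) / D" using D by (simp add: c_def norm_power norm_divide)
    have c0: "c \<noteq> 0" using c D by auto
    define f where "f v = c * g (proj h n v)" for v
    define x where "x = smul (inverse (c * g y)) y"
    have f_bound: "norm (f v) \<le> (1 / 2) ^ (n - 1) / D * (K * p m v)" for v
      unfolding f_def norm_mult c
      by (rule mult_left_mono[OF order_trans[OF g(2) proj_le]]) (use D in simp)
    have "good h n (x, f)"
      unfolding good_def prod.case m_def[symmetric] w_def[symmetric]
    proof (intro conjI allI impI)
      have "vector_space ((*) :: 'k \<Rightarrow> 'k \<Rightarrow> 'k)"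
        by unfold_locales (auto simp: algebra_simps)
      then show "Vector_Spaces.linear smul (*) f"
        unfolding Vector_Spaces.linear_iff using vector_space_axioms
        by (auto simp: f_def proj_add[OF good] proj_smul[OF good] linear_addD[OF g(1)]
            linear_scaleD[OF g(1)] distrib_left)
      show "f x = 1"
        using c0 gy by (simp add: f_def x_def proj_smul[OF good] linear_scaleD[OF g(1)] y_fix
            field_simps)
      have "g 0 = 0" using linear_scaleD[OF g(1), of 0 0] by simp
      then show "f (fst (h i)) = 0" if "i < n" for i
        by (simp add: f_def proj_vec[OF good that])
      show "snd (h i) x = 0" if "i < n" for i
        by (simp add: x_def linear_scaleD[OF lin[OF good[OF that]]] y_def coord_proj[OF good that])
      show "p j x = 0" if "j < m" for j
        using below_lev[of j h n] that by (simp add: x_def p_smul y_def m_def)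
      show "\<exists>C. \<forall>v. norm (f v) \<le> C * p m v"
        using f_bound by (intro exI[of _ "(1 / 2) ^ (n - 1) / D * K"]) (simp add: mult.assoc)
      show "(1 + p l (fst (h l))) * norm (f v) \<le> (1 / 2) ^ l * p m v" if n: "n = Suc l" for l v
      proof -
        let ?q = "1 + p l (fst (h l))"
        have q: "?q > 0" by (rule add_pos_nonneg) auto
        have "?q * norm (f v) \<le> ?q * ((1 / 2) ^ l / D * (K * p m v))"
          using f_bound[of v] q n by (intro mult_left_mono) auto
        also have "\<dots> = (1 / 2) ^ l * p m v"
          using q K n by (simp add: D_def)
        finally show ?thesis .
      qed
      show "\<exists>a\<in>span (insert x (fst ` h ` {..<n})). p n (a - w) < 1 / real (Suc n)"
      proof
        have "y = smul (c * g y) x" using c0 gy by (simp add: x_def field_simps)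
        then have "y \<in> span (insert x (fst ` h ` {..<n}))"
          by (metis insertI1 span_base span_scale)
        moreover have "(\<Sum>i<n. smul (snd (h i) a) (fst (h i))) \<in> span (insert x (fst ` h ` {..<n}))"
          by (intro span_sum span_scale span_base) auto
        moreover have "a = y + (\<Sum>i<n. smul (snd (h i) a) (fst (h i)))"
          by (simp add: y_def proj_def)
        ultimately show "a \<in> span (insert x (fst ` h ` {..<n}))" by (metis span_add)
      qed (rule a(2))
    qed
    then show ?thesis ..
  qed
  obtain h where h: "\<And>n. good h n (h n)"
    using dependent_wellorder_choice[of good, OF good_cong step] by blast
  define x where "x i = fst (h i)" for i
  define f where "f i = snd (h i)" for i
  define L where "L = lev h"
  have h': "f n (x n) = 1" "\<And>m. m < L n \<Longrightarrow> p m (x n) = 0"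
      "\<And>v. (1 + p n (x n)) * norm (f (Suc n) v) \<le> (1 / 2) ^ n * p (L (Suc n)) v"
      "\<exists>a\<in>span (insert (x n) (fst ` h ` {..<n})).
         p n (a - z (fst (prod_decode n))) < 1 / real (Suc n)" for n
    using h[of n] h[of "Suc n"] by (auto simp: good_def x_def f_def L_def split: prod.splits)
  have L_mono: "i \<le> n \<Longrightarrow> L i \<le> L n" for i n unfolding L_def by (rule lev_mono[OF h])
  show thesis
  proof (rule that; intro allI impI)
    show "Vector_Spaces.linear smul (*) (f i)" for i unfolding f_def by (rule lin[OF h])
    show "f i (x j) = (if i = j then 1 else 0)" for i j
      unfolding f_def x_def by (rule biorth[of "Suc (max i j)"]) (auto intro: h)
  next
    fix v n and e :: real assume e: "e > 0"
    obtain i where i: "p n (z i - v) < e / 2" using dense[of "e / 2"] e by auto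
    obtain N where N: "1 / real (Suc N) < e / 2"
      using reals_Archimedean[of "e / 2"] e by (auto simp: inverse_eq_divide)
    define k where "k = prod_encode (i, max n N)"
    have k: "n \<le> k" "N \<le> k" using le_prod_encode_2[of "max n N" i] by (auto simp: k_def)
    obtain a where a: "a \<in> span (insert (x k) (fst ` h ` {..<k}))" "p k (a - z i) < 1 / real (Suc k)"
      using h'(4)[of k] by (auto simp: k_def)
    have "insert (x k) (fst ` h ` {..<k}) \<subseteq> range x" by (auto simp: x_def)
    then have "a \<in> span (range x)" using a(1) span_mono by blast
    moreover have "p n (a - v) < e"
    proof -
      have "p n (a - z i) \<le> p k (a - z i)" by (rule p_mono[OF k(1)])
      moreover have "1 / real (Suc k) \<le> 1 / real (Suc N)" using k(2) by (simp add: frac_le)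
      ultimately show ?thesis using a(2) i N p_triangle[of n a v "z i"] by linarith
    qed
    ultimately show "\<exists>w\<in>span (range x). p n (w - v) < e" by blast
  next
    fix n
    define b where "b i = p n (x i) * ((1 / 2) ^ i / (1 + p i (x i)))" for i
    have pos: "1 + p i (x i) > 0" for i by (rule add_pos_nonneg) auto
    have "\<exists>r. \<forall>i. L i \<le> n \<longrightarrow> L (Suc i) \<le> r"
    proof (cases "\<exists>i0. n < L i0")
      case True
      then obtain i0 where i0: "n < L i0" by blast
      have "L (Suc i) \<le> L i0" if "L i \<le> n" for i
        using L_mono[of i0 i] i0 that by (intro L_mono) linarith
      then show ?thesis by blast
    next
      case False
      then show ?thesis by (meson not_less)
    qed
    then obtain r where r: "\<And>i. L i \<le> n \<Longrightarrow> L (Suc i) \<le> r" by blast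
    have "p n (x i) * norm (f (Suc i) v) \<le> b i * p r v" for i v
    proof (cases "n < L i")
      case True
      then show ?thesis using h'(2)[of n i] by (simp add: b_def)
    next
      case False
      have "norm (f (Suc i) v) \<le> (1 / 2) ^ i * p (L (Suc i)) v / (1 + p i (x i))"
        using h'(3)[of i v] pos[of i] by (simp add: pos_le_divide_eq mult.commute)
      also have "\<dots> \<le> (1 / 2) ^ i * p r v / (1 + p i (x i))"
        by (intro divide_right_mono mult_left_mono p_mono r) (use False pos[of i] in auto)
      finally have "p n (x i) * norm (f (Suc i) v) \<le>
          p n (x i) * ((1 / 2) ^ i * p r v / (1 + p i (x i)))"
        by (rule mult_left_mono) simp
      then show ?thesis by (simp add: b_def)
    qed
    moreover have "summable b"
    proof (rule summable_comparison_test'[of "\<lambda>i. (1 / 2 :: real) ^ i" n])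
      show "summable (\<lambda>i. (1 / 2 :: real) ^ i)" by (simp add: summable_geometric)
      fix i assume "i \<ge> n"
      then have "p n (x i) / (1 + p i (x i)) \<le> 1"
        using p_mono[of n i "x i"] pos[of i] by (simp add: pos_divide_le_eq)
      then have "(1 / 2) ^ i * (p n (x i) / (1 + p i (x i))) \<le> (1 / 2) ^ i * 1"
        by (rule mult_left_mono) simp
      then show "norm (b i) \<le> (1 / 2) ^ i"
        using pos[of i] by (simp add: b_def mult.commute)
    qed
    ultimately show "\<exists>r b. summable b \<and> (\<forall>i v. p n (x i) * norm (f (Suc i) v) \<le> b i * p r v)"
      by blast
  qed
qed

end

section \<open>Dynamics of operators modelled on translation\<close>

lemma low_coeff_eq_0:
  assumes "[:0, 1:] ^ d dvd (G :: 'k::field poly)" "l < d"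
  shows "coeff G l = 0"
proof -
  obtain H where "G = monom 1 d * H" using assms(1) by (auto simp: monom_altdef dvd_def)
  then show ?thesis using assms(2) by (simp add: coeff_monom_mult)
qed

context frechet_grading
begin

lemma tends_to_const: "tends_to (\<lambda>i. l) l"
  by (simp add: tends_to_def)

lemma tends_to_sum:
  assumes "\<And>j. j \<in> J \<Longrightarrow> tends_to (s j) (l j)"
  shows "tends_to (\<lambda>i. \<Sum>j\<in>J. s j i) (\<Sum>j\<in>J. l j)"
  using assms
  by (induction J rule: infinite_finite_induct) (auto intro: tends_to_add tends_to_const)

lemma tends_to_smul_0:
  assumes "c \<longlonglongrightarrow> 0"
  shows "tends_to (\<lambda>i. smul (c i) w) 0"
  unfolding tends_to_def
proof
  fix n
  have "(\<lambda>i. norm (c i) * p n w) \<longlonglongrightarrow> 0 * p n w"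
    using assms by (intro tendsto_mult_right tendsto_norm_zero)
  then show "(\<lambda>i. p n (smul (c i) w - 0)) \<longlonglongrightarrow> 0" by (simp add: p_smul)
qed

lemma tends_to_eventually:
  assumes "tends_to s l" "open U" "l \<in> U"
  shows "\<forall>\<^sub>F i in sequentially. s i \<in> U"
proof -
  from ex_ball_in_open[OF assms(2,3)] obtain n e where
    e: "e > 0" "\<forall>y. p n (y - l) < e \<longrightarrow> y \<in> U" by (elim exE conjE)
  have "\<forall>\<^sub>F i in sequentially. p n (s i - l) < e"
    using assms(1) e(1) unfolding tends_to_def by (intro order_tendstoD(2)) auto
  then show ?thesis by eventually_elim (use e(2) in blast)
qed

text \<open>
  Baire's theorem by the usual nested balls.  At stage \<open>n\<close> the ball has radius below \<open>1 / (n + 1)\<close>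
  with respect to a seminorm of index at least \<open>n\<close>, so that the centres form a Cauchy sequence for
  every seminorm.
\<close>

lemma ex_point_in_dense_open_sets:
  fixes G :: "nat \<Rightarrow> 'a set"
  assumes opn: "\<And>n. open (G n)"
    and dense: "\<And>n V. open V \<Longrightarrow> V \<noteq> {} \<Longrightarrow> V \<inter> G n \<noteq> {}"
  shows "\<exists>v. \<forall>n. v \<in> G n"
proof -
  define cbl where "cbl c = {y. p (fst (snd c)) (y - fst c) \<le> snd (snd c)}" for c :: "'a \<times> nat \<times> real"
  define bl where "bl c = {y. p (fst (snd c)) (y - fst c) < snd (snd c)}" for c :: "'a \<times> nat \<times> real"
  define ok where "ok n c \<longleftrightarrow> snd (snd c) > 0 \<and> snd (snd c) < 1 / real (Suc n) \<and> n \<le> fst (snd c) \<and>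
      cbl c \<subseteq> G n" for n c
  have shrink: "\<exists>c. ok n c \<and> cbl c \<subseteq> V" if V: "open V" "V \<noteq> {}" for V n
  proof -
    obtain x where x: "x \<in> V \<inter> G n" using dense[OF V] by blast
    have "open (V \<inter> G n)" using V(1) opn by blast
    from ex_ball_in_open[OF this x] obtain N e where
      e: "e > 0" "\<forall>y. p N (y - x) < e \<longrightarrow> y \<in> V \<inter> G n" by (elim exE conjE)
    define d where "d = min (e / 2) (1 / (2 * real (Suc n)))"
    have d: "0 < d" "d < e" "d < 1 / real (Suc n)"
      using e(1) by (auto simp: d_def min_less_iff_disj field_simps)
    have "y \<in> V \<inter> G n" if "p (max N n) (y - x) \<le> d" for y
    proof -
      have "p N (y - x) < e" using p_mono[of N "max N n" "y - x"] that d(2) by linarith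
      then show ?thesis using e(2) by blast
    qed
    then show ?thesis
      using d by (intro exI[of _ "(x, max N n, d)"]) (auto simp: ok_def cbl_def)
  qed
  have "\<exists>c. \<forall>n. ok n (c n) \<and> cbl (c (Suc n)) \<subseteq> bl (c n)"
  proof (rule dependent_nat_choice)
    show "\<exists>c. ok 0 c" using shrink[of UNIV 0] by blast
    fix c n assume "ok n c"
    then have "fst c \<in> bl c" by (simp add: ok_def bl_def)
    then show "\<exists>c'. ok (Suc n) c' \<and> cbl c' \<subseteq> bl c"
      using shrink[of "bl c" "Suc n"] open_ball unfolding bl_def by blast
  qed
  then obtain c where c: "\<And>n. ok n (c n)" "\<And>n. cbl (c (Suc n)) \<subseteq> bl (c n)" by blast
  define x where "x n = fst (c n)" for n
  have bl_cbl: "bl (c n) \<subseteq> cbl (c n)" for n by (auto simp: bl_def cbl_def)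
  have nested: "cbl (c j) \<subseteq> cbl (c i)" if "i \<le> j" for i j
    using lift_Suc_antimono_le[of "\<lambda>i. cbl (c i)" i j] c(2) bl_cbl that by blast
  have x_in: "x j \<in> cbl (c i)" if "i \<le> j" for i j
  proof -
    have "x j \<in> cbl (c j)" using c(1)[of j] by (simp add: ok_def cbl_def x_def)
    then show ?thesis using nested[OF that] by blast
  qed
  have "seminorm_Cauchy p x"
    unfolding seminorm_Cauchy_def
  proof (intro allI impI)
    fix n and e :: real assume e: "e > 0"
    obtain N where N: "1 / real (Suc N) < e / 2"
      using reals_Archimedean[of "e / 2"] e by (auto simp: inverse_eq_divide)
    define M where "M = max n N"
    have "p n (x i - x j) < e" if "i \<ge> M" "j \<ge> M" for i j
    proof -
      let ?r = "fst (snd (c M))" and ?d = "snd (snd (c M))"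
      have cM: "?d < 1 / real (Suc M)" "M \<le> ?r" using c(1)[of M] by (auto simp: ok_def)
      have "p ?r (x i - x M) \<le> ?d" "p ?r (x j - x M) \<le> ?d"
        using x_in[OF that(1)] x_in[OF that(2)] by (auto simp: cbl_def x_def)
      moreover have "p ?r (x i - x j) \<le> p ?r (x i - x M) + p ?r (x j - x M)"
        using p_triangle[of ?r "x i" "x j" "x M"] p_diff_commute[of ?r "x M" "x j"] by simp
      moreover have "p n (x i - x j) \<le> p ?r (x i - x j)"
        by (rule p_mono) (use cM(2) in \<open>simp add: M_def\<close>)
      moreover have "1 / real (Suc M) \<le> 1 / real (Suc N)" by (simp add: M_def frac_le)
      ultimately show ?thesis using cM(1) N by linarith
    qed
    then show "\<exists>N. \<forall>i\<ge>N. \<forall>j\<ge>N. p n (x i - x j) < e" by blast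
  qed
  from complete[OF this] obtain l where l: "\<forall>n. (\<lambda>i. p n (x i - l)) \<longlonglongrightarrow> 0" ..
  have "l \<in> cbl (c n)" for n
  proof -
    let ?r = "fst (snd (c n))" and ?d = "snd (snd (c n))"
    have "p ?r (l - x n) \<le> p ?r (x i - l) + ?d" if "i \<ge> n" for i
      using x_in[OF that] p_triangle[of ?r l "x n" "x i"] p_diff_commute[of ?r l "x i"]
      by (simp add: cbl_def x_def)
    moreover have "(\<lambda>i. p ?r (x i - l) + ?d) \<longlonglongrightarrow> 0 + ?d"
      using l by (intro tendsto_add tendsto_const) blast
    ultimately have "p ?r (l - x n) \<le> 0 + ?d" by (intro LIMSEQ_le_const) auto
    then show ?thesis by (simp add: cbl_def x_def)
  qed
  then show ?thesis using c(1) unfolding ok_def by blast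
qed

lemma funpow_continuous:
  assumes "continuous_on UNIV (T :: 'a \<Rightarrow> 'a)"
  shows "continuous_on UNIV (T ^^ n)"
proof (induction n)
  case (Suc n)
  have "continuous_on UNIV (T \<circ> T ^^ n)"
    using continuous_on_compose[OF Suc, of T] continuous_on_subset[OF assms] by blast
  then show ?case by simp
qed (simp add: continuous_on_id id_def)

text \<open>
  The images of polynomials can be steered, in the limit, to arbitrary targets \<open>U\<^sub>l\<close> simultaneously at
  the times \<open>l k\<close> for \<open>l \<le> m\<close>.  Let \<open>d\<close> exceed all degrees, and let \<open>G\<^sub>j\<^sub>i\<close> be the Hermite
  polynomial with the expansion \<open>t\<^sup>i\<close> at \<open>j\<close>.  A combination \<open>W\<close> of the polynomials
  \<open>k\<^sup>i G\<^sub>j\<^sub>i (t / k)\<close> with the coefficients of the \<open>U\<^sub>j\<close> has at \<open>t + l k\<close> the same expansion as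
  \<open>U\<^sub>l\<close>, apart from the error terms \<open>k\<^sup>i R (t / k)\<close> with \<open>R\<close> divisible by \<open>t\<^sup>d\<close> and \<open>i < d\<close>.
  Their coefficients are \<open>O(1 / k)\<close> and their degrees are bounded, so any linear map sends them to a
  null sequence.
\<close>

lemma translation_model_tends_to:
  fixes \<Phi> :: "'k poly \<Rightarrow> 'a" and U :: "nat \<Rightarrow> 'k poly"
  assumes add: "\<And>P Q. \<Phi> (P + Q) = \<Phi> P + \<Phi> Q"
    and scale: "\<And>c P. \<Phi> (smult c P) = smul c (\<Phi> P)"
    and T: "\<And>P. T (\<Phi> P) = \<Phi> (translate 1 P)"
  shows "\<exists>W. \<forall>l\<le>m. tends_to (\<lambda>k. (T ^^ (l * Suc k)) (\<Phi> (W k))) (\<Phi> (U l))"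
proof -
  have zero: "\<Phi> 0 = 0" using scale[of 0 0] by simp
  have sum: "\<Phi> (sum h J) = (\<Sum>j\<in>J. \<Phi> (h j))" for h and J :: "nat set"
    by (induction J rule: infinite_finite_induct) (simp_all add: zero add)
  have iterate: "(T ^^ n) (\<Phi> P) = \<Phi> (translate (of_nat n) P)" for n P
  proof (induction n)
    case (Suc n)
    then show ?case by (simp add: T translate_translate)
  qed simp
  have vanish: "tends_to (\<lambda>k. \<Phi> (smult (of_nat (Suc k) ^ i) (dilate (1 / of_nat (Suc k)) G))) 0"
    if G: "[:0, 1:] ^ d dvd G" and i: "i < d" for d i G
  proof -
    have "tends_to (\<lambda>k. smul (of_nat (Suc k) ^ i * (coeff G l * (1 / of_nat (Suc k)) ^ l))
        (\<Phi> ([:0, 1:] ^ l))) 0" for l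
    proof (cases "l < d")
      case True
      then show ?thesis using low_coeff_eq_0[OF G] by (simp add: tends_to_const)
    next
      case False
      then have l: "l = i + Suc (l - Suc i)" using i by simp
      show ?thesis
      proof (rule tends_to_smul_0)
        have inv: "(\<lambda>k. 1 / of_nat (Suc k) :: 'k) \<longlonglongrightarrow> 0"
          using LIMSEQ_Suc[OF lim_1_over_n] by simp
        have "(\<lambda>k. coeff G l * ((1 / of_nat (Suc k)) * (1 / of_nat (Suc k)) ^ (l - Suc i)))
            \<longlonglongrightarrow> coeff G l * (0 * 0 ^ (l - Suc i))"
          by (intro tendsto_mult_left tendsto_mult tendsto_power inv)
        moreover have "of_nat (Suc k) ^ i * (coeff G l * (1 / of_nat (Suc k)) ^ l) =
            coeff G l * ((1 / of_nat (Suc k)) * (1 / of_nat (Suc k)) ^ (l - Suc i) :: 'k)" for k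
        proof -
          let ?c = "of_nat (Suc k) :: 'k"
          have "?c \<noteq> 0" using of_nat_neq_0 by blast
          then have "?c ^ i * (1 / ?c) ^ i = 1"
            by (simp add: power_mult_distrib[symmetric] del: of_nat_Suc)
          moreover have "(1 / ?c) ^ l = (1 / ?c) ^ i * ((1 / ?c) * (1 / ?c) ^ (l - Suc i))"
            by (subst l) (simp add: power_add del: of_nat_Suc)
          ultimately show ?thesis by (simp add: mult_ac del: of_nat_Suc)
        qed
        ultimately show "(\<lambda>k. of_nat (Suc k) ^ i * (coeff G l * (1 / of_nat (Suc k)) ^ l)) \<longlonglongrightarrow> 0"
          by simp
      qed
    qed
    then have "tends_to (\<lambda>k. \<Sum>l\<le>degree G. smul (of_nat (Suc k) ^ i *
        (coeff G l * (1 / of_nat (Suc k)) ^ l)) (\<Phi> ([:0, 1:] ^ l))) (\<Sum>l\<le>degree G. 0)"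
      by (rule tends_to_sum)
    then show ?thesis
      by (simp add: scale dilate_as_sum sum scale_sum_right del: of_nat_Suc)
  qed
  define d where "d = Suc (\<Sum>j\<le>m. degree (U j))"
  have deg: "degree (U j) \<le> d - 1" if "j \<le> m" for j
    using member_le_sum[of j "{..m}" "\<lambda>j. degree (U j)"] that by (simp add: d_def)
  have "\<exists>G :: 'k poly. \<forall>l\<le>m. [:0, 1:] ^ d dvd
      translate (of_nat l) G - (if l = j then [:0, 1:] ^ i else 0)" if "j \<le> m" for i j
    using ex_hermite_polynomial[OF that, of d i] by metis
  then have "\<exists>G :: nat \<Rightarrow> nat \<Rightarrow> 'k poly. \<forall>j\<le>m. \<forall>i. \<forall>l\<le>m. [:0, 1:] ^ d dvd
      translate (of_nat l) (G j i) - (if l = j then [:0, 1:] ^ i else 0)" by metis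
  then obtain G :: "nat \<Rightarrow> nat \<Rightarrow> 'k poly" where G: "\<And>j i l. j \<le> m \<Longrightarrow> l \<le> m \<Longrightarrow> [:0, 1:] ^ d dvd
      translate (of_nat l) (G j i) - (if l = j then [:0, 1:] ^ i else 0)" by blast
  define W where "W k = (\<Sum>j\<le>m. \<Sum>i<d. smult (coeff (U j) i)
      (smult (of_nat (Suc k) ^ i) (dilate (1 / of_nat (Suc k)) (G j i))))" for k
  have "tends_to (\<lambda>k. (T ^^ (l * Suc k)) (\<Phi> (W k))) (\<Phi> (U l))" if l: "l \<le> m" for l
  proof -
    define R where "R j i = translate (of_nat l) (G j i) - (if l = j then [:0, 1:] ^ i else 0)" for j i
    have image: "(T ^^ (l * Suc k)) (\<Phi> (W k)) = \<Phi> (U l) + (\<Sum>j\<le>m. \<Sum>i<d. smul (coeff (U j) i)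
        (\<Phi> (smult (of_nat (Suc k) ^ i) (dilate (1 / of_nat (Suc k)) (R j i)))))" for k
    proof -
      let ?K = "of_nat (Suc k) :: 'k"
      have K: "?K \<noteq> 0" using of_nat_neq_0 by blast
      have "translate (of_nat (l * Suc k)) (W k) =
          (\<Sum>j\<le>m. \<Sum>i<d. smult (coeff (U j) i)
             (smult (?K ^ i) (dilate (1 / ?K) (translate (of_nat l) (G j i)))))"
        unfolding W_def of_nat_mult pcompose_sum pcompose_smult translate_dilate[OF K] ..
      also have "\<dots> = (\<Sum>j\<le>m. \<Sum>i<d. smult (coeff (U j) i) (smult (?K ^ i)
            (dilate (1 / ?K) (if l = j then [:0, 1:] ^ i else 0)))) +
          (\<Sum>j\<le>m. \<Sum>i<d. smult (coeff (U j) i) (smult (?K ^ i) (dilate (1 / ?K) (R j i))))"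
        unfolding sum.distrib[symmetric] smult_add_right[symmetric] pcompose_add[symmetric]
        by (simp add: R_def del: of_nat_Suc)
      also have "(\<Sum>j\<le>m. \<Sum>i<d. smult (coeff (U j) i) (smult (?K ^ i)
            (dilate (1 / ?K) (if l = j then [:0, 1:] ^ i else 0)))) =
          (\<Sum>j\<le>m. if l = j then U j else 0)"
      proof (rule sum.cong[OF refl])
        fix j assume j: "j \<in> {..m}"
        have "smult (?K ^ i) (dilate (1 / ?K) ([:0, 1:] ^ i)) = [:0, 1:] ^ i" for i
        proof -
          have "dilate (1 / ?K) ([:0, 1:] ^ i) = smult (1 / ?K) [:0, 1:] ^ i"
            by (simp add: pcompose_power pcompose_pCons del: of_nat_Suc)
          then show ?thesis
            using K by (simp add: smult_power[symmetric] power_one_over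
                del: of_nat_Suc smult_pCons)
        qed
        moreover have "(\<Sum>i<d. smult (coeff (U j) i) ([:0, 1:] ^ i)) = U j"
          using poly_as_sum_of_monoms'[OF deg[of j]] j
          by (simp add: monom_altdef d_def lessThan_Suc_atMost)
        ultimately show "(\<Sum>i<d. smult (coeff (U j) i) (smult (?K ^ i)
            (dilate (1 / ?K) (if l = j then [:0, 1:] ^ i else 0)))) = (if l = j then U j else 0)"
          by (simp del: of_nat_Suc smult_smult)
      qed
      also have "\<dots> = U l" using l by simp
      finally show ?thesis
        unfolding iterate by (simp add: add sum scale del: of_nat_Suc smult_smult scale_scale)
    qed
    have "tends_to (\<lambda>k. \<Sum>j\<le>m. \<Sum>i<d. smul (coeff (U j) i)
        (\<Phi> (smult (of_nat (Suc k) ^ i) (dilate (1 / of_nat (Suc k)) (R j i)))))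
        (\<Sum>j\<le>m. \<Sum>i<d. smul (coeff (U j) i) 0)"
    proof (intro tends_to_sum tends_to_smul vanish[of d])
      show "[:0, 1:] ^ d dvd R j i" if "j \<in> {..m}" for j i
        unfolding R_def by (rule G) (use that l in auto)
    qed auto
    from tends_to_add[OF tends_to_const this] show ?thesis
      unfolding image by simp
  qed
  then show ?thesis by blast
qed

text \<open>
  Steering to a point of \<open>V\<close> at time \<open>0\<close> and to points of \<open>U\<close> at the times \<open>k, 2 k, ..., m k\<close>
  shows that the vectors which visit \<open>U\<close> along such a progression form a dense open set.  Baire's
  theorem yields one vector that works for all \<open>m\<close> and for all \<open>U\<close> of a countable family of balls
  such that every nonempty open set contains one of them.
\<close>

lemma AP_hypercyclic_translation_model:
  fixes \<Phi> :: "'k poly \<Rightarrow> 'a" and z :: "nat \<Rightarrow> 'a"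
  assumes add: "\<And>P Q. \<Phi> (P + Q) = \<Phi> P + \<Phi> Q"
    and scale: "\<And>c P. \<Phi> (smult c P) = smul c (\<Phi> P)"
    and T: "\<And>P. T (\<Phi> P) = \<Phi> (translate 1 P)"
    and cont: "continuous_on UNIV T"
    and dense: "\<And>v n e. e > 0 \<Longrightarrow> \<exists>P. p n (\<Phi> P - v) < e"
    and sep: "\<And>v n e. e > 0 \<Longrightarrow> \<exists>i. p n (z i - v) < e"
  shows "AP_hypercyclic T"
proof -
  have dense': "\<exists>P. \<Phi> P \<in> V" if V: "open V" "V \<noteq> {}" for V
  proof -
    obtain v where "v \<in> V" using V by blast
    from ex_ball_in_open[OF V(1) this] obtain n e where
      e: "e > 0" "\<forall>y. p n (y - v) < e \<longrightarrow> y \<in> V" by (elim exE conjE)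
    then show ?thesis using dense by blast
  qed
  define G where "G U m = {v. \<exists>k. \<forall>l\<in>{1..m}. (T ^^ (l * Suc k)) v \<in> U}" for U m
  have open_G: "open (G U m)" if "open U" for U m
  proof -
    have G: "G U m = (\<Union>k. \<Inter>l\<in>{1..m}. (T ^^ (l * Suc k)) -` U)" by (auto simp: G_def)
    have "open ((T ^^ n) -` U)" for n
      using continuous_on_open_vimage[OF open_UNIV, THEN iffD1, OF funpow_continuous[OF cont]] that
      by simp
    then show ?thesis unfolding G by (intro open_UN open_INT ballI) auto
  qed
  have dense_G: "V \<inter> G U m \<noteq> {}" if V: "open V" "V \<noteq> {}" and U: "open U" "U \<noteq> {}" for U V m
  proof -
    obtain P Q where PQ: "\<Phi> P \<in> V" "\<Phi> Q \<in> U" using dense' V U by metis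
    define goal where "goal l = (if l = 0 then P else Q)" for l :: nat
    obtain W where W: "\<forall>l\<le>m. tends_to (\<lambda>k. (T ^^ (l * Suc k)) (\<Phi> (W k))) (\<Phi> (goal l))"
      using translation_model_tends_to[OF add scale T] by blast
    have "\<forall>\<^sub>F k in sequentially. \<Phi> (W k) \<in> V"
      by (rule tends_to_eventually[OF _ V(1), of _ "\<Phi> P"])
        (use W[rule_format, of 0] PQ in \<open>simp_all add: goal_def\<close>)
    moreover have "\<forall>\<^sub>F k in sequentially. \<forall>l\<in>{1..m}. (T ^^ (l * Suc k)) (\<Phi> (W k)) \<in> U"
    proof (rule eventually_ball_finite)
      show "\<forall>l\<in>{1..m}. \<forall>\<^sub>F k in sequentially. (T ^^ (l * Suc k)) (\<Phi> (W k)) \<in> U"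
      proof
        fix l assume l: "l \<in> {1..m}"
        show "\<forall>\<^sub>F k in sequentially. (T ^^ (l * Suc k)) (\<Phi> (W k)) \<in> U"
          by (rule tends_to_eventually[OF _ U(1), of _ "\<Phi> Q"])
            (use W[rule_format, of l] l PQ in \<open>simp_all add: goal_def\<close>)
      qed
    qed simp
    ultimately have "\<forall>\<^sub>F k in sequentially. \<Phi> (W k) \<in> V \<and>
        (\<forall>l\<in>{1..m}. (T ^^ (l * Suc k)) (\<Phi> (W k)) \<in> U)" by (rule eventually_conj)
    then obtain k where "\<Phi> (W k) \<in> V" "\<forall>l\<in>{1..m}. (T ^^ (l * Suc k)) (\<Phi> (W k)) \<in> U"
      using eventually_happens by force
    then have "\<Phi> (W k) \<in> V \<inter> G U m" by (auto simp: G_def)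
    then show ?thesis by blast
  qed
  define B where "B i k = {y. p k (y - z i) < 1 / real (Suc k)}" for i k
  have B: "open (B i k)" "B i k \<noteq> {}" for i k
  proof -
    show "open (B i k)" unfolding B_def by (rule open_ball)
    have "z i \<in> B i k" by (simp add: B_def)
    then show "B i k \<noteq> {}" by blast
  qed
  have "\<exists>v. \<forall>n. v \<in> (case prod_decode n of (i, n') \<Rightarrow> case prod_decode n' of (k, m) \<Rightarrow> G (B i k) m)"
    by (rule ex_point_in_dense_open_sets)
      (auto split: prod.splits intro!: open_G B simp: dense_G[OF _ _ B])
  then obtain v where all: "\<forall>n. v \<in> (case prod_decode n of (i, n') \<Rightarrow>
      case prod_decode n' of (k, m) \<Rightarrow> G (B i k) m)" ..
  have v: "v \<in> G (B i k) m" for i k m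
    using all[rule_format, of "prod_encode (i, prod_encode (k, m))"] by simp
  show ?thesis
    unfolding AP_hypercyclic_def
  proof (intro exI[of _ v] allI impI)
    fix U :: "'a set" assume U: "open U \<and> U \<noteq> {}"
    then obtain u where "u \<in> U" by blast
    from ex_ball_in_open[OF conjunct1[OF U] this] obtain n e where
      e: "e > 0" "\<forall>y. p n (y - u) < e \<longrightarrow> y \<in> U" by (elim exE conjE)
    obtain N where N: "1 / real (Suc N) < e / 2"
      using reals_Archimedean[of "e / 2"] e(1) by (auto simp: inverse_eq_divide)
    define k where "k = max n N"
    have k: "1 / real (Suc k) < e / 2" "n \<le> k"
      using N frac_le[of 1 1 "real (Suc N)" "real (Suc k)"] by (auto simp: k_def)
    obtain i where i: "p n (z i - u) < e / 2" using sep[of "e / 2" n u] e(1) by auto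
    have BU: "B i k \<subseteq> U"
    proof
      fix y assume "y \<in> B i k"
      then have "p k (y - z i) < e / 2" using k(1) by (simp add: B_def)
      then have "p n (y - u) < e"
        using p_mono[OF k(2), of "y - z i"] p_triangle[of n y u "z i"] i by linarith
      then show "y \<in> U" using e(2) by blast
    qed
    show "return_set T v U \<in> AP"
      unfolding AP_def
    proof (intro CollectI allI)
      fix m
      (* The visits at K, 2 K, ..., (m + 1) K, where K = Suc k', form a progression of m + 1 terms. *)
      obtain k' where k': "\<forall>l\<in>{1..Suc m}. (T ^^ (l * Suc k')) v \<in> B i k"
        using v[of i k "Suc m"] by (auto simp: G_def)
      have "Suc k' + j * Suc k' \<in> return_set T v U" if "j \<le> m" for j
      proof -
        have "(T ^^ (Suc j * Suc k')) v \<in> B i k" by (rule k'[rule_format]) (use that in auto)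
        moreover have "Suc k' + j * Suc k' = Suc j * Suc k'" by simp
        ultimately show ?thesis unfolding return_set_def using BU by (metis mem_Collect_eq subsetD)
      qed
      then show "\<exists>a k. k \<ge> 1 \<and> {a + j * k |j. j \<le> m} \<subseteq> return_set T v U"
        by (intro exI[of _ "Suc k'"]) auto
    qed
  qed
qed

end

section \<open>Existence of the operator\<close>

lemma (in vector_space) span_finite_neq_UNIV:
  assumes "infinite_dimensional scale" "finite B"
  shows "span B \<noteq> UNIV"
proof
  assume UNIV: "span B = UNIV"
  obtain C where C: "C \<subseteq> B" "independent C" "B \<subseteq> span C"
    using maximal_independent_subset[of B] by blast
  have "span B \<subseteq> span C" using C(3) span_minimal subspace_span by blast
  then have "span C = UNIV" using UNIV by blast
  moreover have "finite C" using C(1) assms(2) finite_subset by blast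
  ultimately have "finite_dimensional_vector_space scale C"
    using C(2) by unfold_locales
  then show False using assms(1) unfolding infinite_dimensional_def by blast
qed

lemma (in frechet_grading) ex_dense_sequence:
  assumes "separable_space (euclidean :: 'a topology)"
  obtains z :: "nat \<Rightarrow> 'a" where "\<forall>v n e. e > 0 \<longrightarrow> (\<exists>i. p n (z i - v) < e)"
proof -
  obtain C :: "'a set" where C: "countable C" "euclidean closure_of C = (UNIV :: 'a set)"
    using assms by (auto simp: separable_space_def)
  have meets: "\<exists>c\<in>C. p n (c - v) < e" if "e > 0" for v n e
  proof -
    let ?B = "{y. p n (y - v) < e}"
    have "v \<in> ?B \<inter> closure C" using C(2) that by simp
    then have "?B \<inter> C \<noteq> {}" using open_Int_closure_eq_empty[OF open_ball] by blast
    then show ?thesis by blast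
  qed
  then have "C \<noteq> {}" using zero_less_one by blast
  then have range: "range (from_nat_into C) = C" using C(1) by (simp add: range_from_nat_into)
  show thesis
  proof (rule that, intro allI impI)
    show "\<exists>i. p n (from_nat_into C i - v) < e" if "e > 0" for v n e
      using meets[OF that, of n v] range by (metis rangeE)
  qed
qed

text \<open>
  With a biorthogonal sequence \<open>x, f\<close> at hand, the operator is \<open>v + \<Sum>\<^sub>l f\<^sub>l\<^sub>+\<^sub>1(v) x\<^sub>l\<close>.
  It fixes \<open>x\<^sub>0\<close> and maps \<open>x\<^sub>l\<^sub>+\<^sub>1\<close> to \<open>x\<^sub>l\<^sub>+\<^sub>1 + x\<^sub>l\<close>, which is how \<open>P(t) \<mapsto> P(t + 1)\<close> acts on the
  binomial polynomials.
\<close>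

lemma (in frechet_grading) ex_AP_hypercyclic_operator:
  assumes norming: "norming_functionals smul"
    and infdim: "infinite_dimensional smul"
    and separable: "separable_space (euclidean :: 'a topology)"
  shows "\<exists>T. Vector_Spaces.linear smul smul T \<and> continuous_on UNIV T \<and> AP_hypercyclic T"
proof -
  obtain z :: "nat \<Rightarrow> 'a" where z: "\<forall>v n e. e > 0 \<longrightarrow> (\<exists>i. p n (z i - v) < e)"
    by (rule ex_dense_sequence[OF separable])
  obtain x :: "nat \<Rightarrow> 'a" and f :: "nat \<Rightarrow> 'a \<Rightarrow> 'k" where
    lin: "\<forall>i. Vector_Spaces.linear smul (*) (f i)"
    and biorth: "\<forall>i j. f i (x j) = (if i = j then 1 else 0)"
    and dense: "\<forall>v n e. e > 0 \<longrightarrow> (\<exists>w\<in>span (range x). p n (w - v) < e)"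
    and bound: "\<forall>n. \<exists>r b. summable b \<and> (\<forall>i v. p n (x i) * norm (f (Suc i) v) \<le> b i * p r v)"
    by (rule ex_biorthogonal_sequence[OF norming span_finite_neq_UNIV[OF infdim] z[rule_format]])
  obtain S where S: "Vector_Spaces.linear smul smul S"
    and S_bound: "\<forall>n. \<exists>r C. \<forall>v. p n (S v) \<le> C * p r v"
    and S_sums: "\<forall>v. tends_to (\<lambda>N. \<Sum>i<N. smul (f (Suc i) v) (x i)) (S v)"
    by (rule nuclear_operator[of "\<lambda>i. f (Suc i)" x, OF lin[rule_format] bound[rule_format]])
  have S_x: "S (x j) = (case j of 0 \<Rightarrow> 0 | Suc l \<Rightarrow> x l)" (is "_ = ?w") for j
  proof (rule tends_to_unique[OF S_sums[rule_format]])
    have "(\<Sum>i<N. smul (f (Suc i) (x j)) (x i)) = ?w" if "N \<ge> j" for N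
    proof (cases j)
      case 0
      then show ?thesis by (simp add: biorth)
    next
      case (Suc l)
      have "(\<Sum>i<N. smul (f (Suc i) (x j)) (x i)) = (\<Sum>i<N. if i = l then x i else 0)"
        by (rule sum.cong) (simp_all add: biorth Suc)
      then show ?thesis using that Suc by simp
    qed
    then have ev: "\<forall>\<^sub>F N in sequentially. p n ((\<Sum>i<N. smul (f (Suc i) (x j)) (x i)) - ?w) = 0" for n
      unfolding eventually_sequentially by (intro exI[of _ j]) simp
    show "tends_to (\<lambda>N. \<Sum>i<N. smul (f (Suc i) (x j)) (x i)) ?w"
      unfolding tends_to_def by (rule allI) (rule tendsto_eventually[OF ev])
  qed
  define T where "T v = v + S v" for v
  have T_lin: "Vector_Spaces.linear smul smul T"
    by (rule linear_smulI)
      (simp_all add: T_def linear_addD[OF S] linear_scaleD[OF S] scale_right_distrib)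
  have T_cont: "continuous_on UNIV T"
  proof (rule continuous_linearI[OF T_lin])
    fix n
    from S_bound[rule_format, of n] obtain r C where C: "\<forall>v. p n (S v) \<le> C * p r v" by (elim exE)
    have "p n (T v) \<le> (1 + \<bar>C\<bar>) * p (max n r) v" for v
    proof -
      have "p n v \<le> p (max n r) v" by (rule p_mono) simp
      moreover have "C * p r v \<le> \<bar>C\<bar> * p (max n r) v"
        by (intro mult_mono p_mono) auto
      ultimately show ?thesis
        using p_add[of n v "S v"] C[rule_format, of v] by (simp add: T_def distrib_right)
    qed
    then show "\<exists>r C. \<forall>v. p n (T v) \<le> C * p r v" by blast
  qed
  (* Newton expansion, with x l in place of the l-th binomial polynomial. *)
  define \<Phi> where "\<Phi> P = (\<Sum>l\<le>degree P. smul (poly ((fdiff ^^ l) P) 0) (x l))" for P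
  have \<Phi>: "\<Phi> P = (\<Sum>l<N. smul (poly ((fdiff ^^ l) P) 0) (x l))" if "degree P < N" for P N
    unfolding \<Phi>_def
    by (rule sum.mono_neutral_left) (use that in \<open>auto simp: fdiff_power_eq_0\<close>)
  have \<Phi>_add: "\<Phi> (P + Q) = \<Phi> P + \<Phi> Q" for P Q
  proof -
    define N where "N = Suc (max (degree P) (degree Q))"
    have "degree (P + Q) < N" "degree P < N" "degree Q < N"
      using degree_add_le_max[of P Q] by (auto simp: N_def)
    then show ?thesis
      by (simp add: \<Phi>[of _ N] fdiff_power_add scale_left_distrib sum.distrib)
  qed
  have \<Phi>_smult: "\<Phi> (smult c P) = smul c (\<Phi> P)" for c P
    using degree_smult_le[of c P]
    by (simp add: \<Phi>[of _ "Suc (degree P)"] fdiff_power_smult scale_sum_right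
        del: sum.lessThan_Suc)
  have \<Phi>_newton: "\<Phi> (newton l) = x l" for l
  proof -
    define N where "N = Suc (max l (degree (newton l :: 'k poly)))"
    have N: "degree (newton l :: 'k poly) < N" by (simp add: N_def)
    have "\<Phi> (newton l) = (\<Sum>j<N. if j = l then x j else 0)"
      unfolding \<Phi>[OF N] by (rule sum.cong) (simp_all add: fdiff_power_newton)
    then show ?thesis by (simp add: N_def)
  qed
  have S_\<Phi>: "S (\<Phi> P) = \<Phi> (fdiff P)" for P
  proof -
    interpret S: Vector_Spaces.linear smul smul S by (rule S)
    define N where "N = Suc (degree P)"
    have "degree (translate 1 P) = degree P" by (simp add: degree_pcompose)
    then have deg: "degree (fdiff P) < N"
      using degree_diff_le[of "translate 1 P" "degree P" P] by (simp add: fdiff_def N_def)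
    have "S (\<Phi> P) = (\<Sum>l<Suc N. smul (poly ((fdiff ^^ l) P) 0) (S (x l)))"
      by (subst \<Phi>[of P "Suc N"]) (simp_all add: N_def S.sum S.scale S.add)
    also have "\<dots> = (\<Sum>l<N. smul (poly ((fdiff ^^ l) (fdiff P)) 0) (x l))"
      by (simp add: sum.lessThan_Suc_shift S_x funpow_swap1 del: sum.lessThan_Suc)
    also have "\<dots> = \<Phi> (fdiff P)" using \<Phi>[OF deg] by simp
    finally show ?thesis .
  qed
  have T_\<Phi>: "T (\<Phi> P) = \<Phi> (translate 1 P)" for P
    using \<Phi>_add[of P "fdiff P"] by (simp add: T_def S_\<Phi>) (simp add: fdiff_def)
  have range_\<Phi>: "span (range x) \<subseteq> range \<Phi>"
  proof (rule span_minimal)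
    show "range x \<subseteq> range \<Phi>" using \<Phi>_newton by (metis image_subsetI rangeI)
    show "subspace (range \<Phi>)"
    proof (rule subspaceI)
      show "0 \<in> range \<Phi>" using \<Phi>_smult[of 0 0] by (metis rangeI scale_zero_left)
      fix u v assume "u \<in> range \<Phi>" "v \<in> range \<Phi>"
      then obtain P Q where "u = \<Phi> P" "v = \<Phi> Q" by blast
      then have "u + v = \<Phi> (P + Q)" by (simp add: \<Phi>_add)
      then show "u + v \<in> range \<Phi>" by blast
    next
      fix c u assume "u \<in> range \<Phi>"
      then obtain P where "u = \<Phi> P" by blast
      then have "smul c u = \<Phi> (smult c P)" by (simp add: \<Phi>_smult)
      then show "smul c u \<in> range \<Phi>" by blast
    qed
  qed
  have \<Phi>_dense: "\<exists>P. p n (\<Phi> P - v) < e" if "e > 0" for v n e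
    using dense[rule_format, OF that, of n v] range_\<Phi> by blast
  have "AP_hypercyclic T"
    by (rule AP_hypercyclic_translation_model[OF \<Phi>_add \<Phi>_smult T_\<Phi> T_cont \<Phi>_dense z[rule_format]])
  then show ?thesis using T_lin T_cont by blast
qed

lemma (in frechet_space) ex_AP_hypercyclic_operator:
  assumes "norming_functionals smul" "infinite_dimensional smul"
    and "separable_space (euclidean :: 'a topology)"
  shows "\<exists>T. Vector_Spaces.linear smul smul T \<and> continuous_on UNIV T \<and> AP_hypercyclic T"
proof -
  obtain p where p: "frechet_grading smul p" by (rule ex_grading)
  show ?thesis by (rule frechet_grading.ex_AP_hypercyclic_operator[OF p assms])
qed

theorem corollary2p6:
  shows
    "(\<forall>smul :: real \<Rightarrow> 'a::{ab_group_add, topological_space} \<Rightarrow> 'a.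
        frechet_space smul \<and> infinite_dimensional smul \<and>
        separable_space (euclidean :: 'a topology) \<longrightarrow>
        (\<exists>T :: 'a \<Rightarrow> 'a.
           Vector_Spaces.linear smul smul T \<and> continuous_on UNIV T \<and> AP_hypercyclic T)) \<and>
     (\<forall>smul :: complex \<Rightarrow> 'a \<Rightarrow> 'a.
        frechet_space smul \<and> infinite_dimensional smul \<and>
        separable_space (euclidean :: 'a topology) \<longrightarrow>
        (\<exists>T :: 'a \<Rightarrow> 'a.
           Vector_Spaces.linear smul smul T \<and> continuous_on UNIV T \<and> AP_hypercyclic T))"
proof (intro conjI allI impI; elim conjE)
  fix smul :: "real \<Rightarrow> 'a \<Rightarrow> 'a"
  assume "frechet_space smul" "infinite_dimensional smul"
    "separable_space (euclidean :: 'a topology)"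
  then show "\<exists>T. Vector_Spaces.linear smul smul T \<and> continuous_on UNIV T \<and> AP_hypercyclic T"
    by (intro frechet_space.ex_AP_hypercyclic_operator norming_functionals_real
        frechet_space.axioms(1))
next
  fix smul :: "complex \<Rightarrow> 'a \<Rightarrow> 'a"
  assume "frechet_space smul" "infinite_dimensional smul"
    "separable_space (euclidean :: 'a topology)"
  then show "\<exists>T. Vector_Spaces.linear smul smul T \<and> continuous_on UNIV T \<and> AP_hypercyclic T"
    by (intro frechet_space.ex_AP_hypercyclic_operator norming_functionals_complex
        frechet_space.axioms(1))
qed

end
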